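(* Let $\varphi:\mathbb{D}\to\mathbb{D}$ be holomorphic, $\varphi\notin\mathrm{Aut}(\mathbb{D})$, with $\varphi(\alpha)=\alpha$ and $\varphi'(\alpha)\neq0$ for some $\alpha\in\mathbb{D}$. Let $X$ be a Banach space with $X\hookrightarrow\mathrm{Hol}(\mathbb{D})$ and $C_\varphi X\subset X$, and let $T={C_\varphi}_{|X}$. The following assertions are equivalent: (i) $0\notin\sigma(T)$; (ii) for only finitely many $n\in\mathbb{N}_0$ one has ${\Psi_n}_{|X}\neq0$; (iii) there exists a finite set $J\subset\mathbb{N}_0$ such that $X=\mathrm{Span}\{\kappa^l:l\in J\}$; (iv) $\dim X<\infty$.
   Context: $\mathbb{D}$ is the open unit disc, $\mathrm{Hol}(\mathbb{D})$ the Fréchet space of holomorphic functions on $\mathbb{D}$ (uniform convergence on compact sets), $\mathrm{Aut}(\mathbb{D})$ the group of holomorphic automorphisms of $\mathbb{D}$, $\mathbb{N}_0=\{0,1,2,\dots\}$, $\mathbb{N}=\{1,2,\dots\}$, $C_\varphi f=f\circ\varphi$. $X\hookrightarrow\mathrm{Hol}(\mathbb{D})$ means that $X$ is a linear subspace of $\mathrm{Hol}(\mathbb{D})$ with continuous inclusion; $T$ is bounded on $X$ by the closed graph theorem, with spectrum $\sigma(T)$. $\kappa$ is Koenigs' eigenfunction: the unique $\kappa\in\mathrm{Hol}(\mathbb{D})$ with $\kappa\circ\varphi=\varphi'(\alpha)\kappa$ and $\kappa'(\alpha)=1$ (Koenigs' theorem); $\kappa^0=1$. Rank-one projections $P_n$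 on $\mathrm{Hol}(\mathbb{D})$ are defined inductively by $P_0f=f(\alpha)\cdot1$ and, for $n\in\mathbb{N}$, $P_nf=\frac1{n!}g^{(n)}(\alpha)\kappa^n$ with $g=f-\sum_{k=0}^{n-1}P_kf$. $\Psi_n$ is the continuous linear functional on $\mathrm{Hol}(\mathbb{D})$ determined by $P_nf=\langle\Psi_n,f\rangle\kappa^n$; it is a linear combination of $f\mapsto f^{(m)}(\alpha)$, $0\le m\le n$. *)

theory Defs
  imports "HOL-Complex_Analysis.Complex_Analysis" "HOL-Library.Function_Algebras"
begin

abbreviation unit_disc :: "complex set" where
  "unit_disc \<equiv> ball 0 1"

text \<open>Functions on the disc are represented by functions on the whole plane that vanish off the
  disc, so that two of them are equal in HOL iff they agree on the disc.\<close>

definition on_disc :: "(complex \<Rightarrow> complex) \<Rightarrow> complex \<Rightarrow> complex" where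
  "on_disc f = (\<lambda>z. if z \<in> unit_disc then f z else 0)"

definition Hol_disc :: "(complex \<Rightarrow> complex) set" where
  "Hol_disc = {f. f holomorphic_on unit_disc \<and> (\<forall>z. z \<notin> unit_disc \<longrightarrow> f z = 0)}"

interpretation cfun: vector_space "\<lambda>(c::complex) (f::complex \<Rightarrow> complex) z. c * f z"
  by unfold_locales (auto simp: fun_eq_iff algebra_simps)

definition Aut_disc :: "(complex \<Rightarrow> complex) \<Rightarrow> bool" where
  "Aut_disc \<phi> \<longleftrightarrow> \<phi> holomorphic_on unit_disc \<and> \<phi> ` unit_disc \<subseteq> unit_disc \<and>
     (\<exists>\<psi>. \<psi> holomorphic_on unit_disc \<and> \<psi> ` unit_disc \<subseteq> unit_disc \<and>
          (\<forall>z\<in>unit_disc. \<psi> (\<phi> z) = z \<and> \<phi> (\<psi> z) = z))"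

definition comp_op :: "(complex \<Rightarrow> complex) \<Rightarrow> (complex \<Rightarrow> complex) \<Rightarrow> complex \<Rightarrow> complex" where
  "comp_op \<phi> f = on_disc (f \<circ> \<phi>)"

text \<open>A Banach space of functions is given by its carrier \<open>X\<close> and its norm \<open>N\<close>; the values of
  \<open>N\<close> off \<open>X\<close> are irrelevant.\<close>

definition banach_on :: "(complex \<Rightarrow> complex) set \<Rightarrow> ((complex \<Rightarrow> complex) \<Rightarrow> real) \<Rightarrow> bool" where
  "banach_on X N \<longleftrightarrow>
     cfun.subspace X \<and>
     (\<forall>f\<in>X. 0 \<le> N f) \<and>
     (\<forall>f\<in>X. N f = 0 \<longleftrightarrow> f = 0) \<and>
     (\<forall>c. \<forall>f\<in>X. N (\<lambda>z. c * f z) = cmod c * N f) \<and>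
     (\<forall>f\<in>X. \<forall>g\<in>X. N (f + g) \<le> N f + N g) \<and>
     (\<forall>s. (\<forall>n. s n \<in> X) \<and> (\<forall>e>0. \<exists>M. \<forall>m\<ge>M. \<forall>n\<ge>M. N (s m - s n) < e) \<longrightarrow>
          (\<exists>f\<in>X. (\<lambda>n. N (s n - f)) \<longlonglongrightarrow> 0))"

text \<open>Both topologies are metrizable, so continuity of the inclusion is sequential continuity.\<close>

definition embedded_in_Hol ::
    "(complex \<Rightarrow> complex) set \<Rightarrow> ((complex \<Rightarrow> complex) \<Rightarrow> real) \<Rightarrow> bool" where
  "embedded_in_Hol X N \<longleftrightarrow>
     X \<subseteq> Hol_disc \<and>
     (\<forall>s f. (\<forall>n. s n \<in> X) \<and> f \<in> X \<and> (\<lambda>n. N (s n - f)) \<longlonglongrightarrow> 0 \<longrightarrow>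
        (\<forall>K. compact K \<and> K \<subseteq> unit_disc \<longrightarrow> uniform_limit K s f sequentially))"

definition bounded_op_on :: "(complex \<Rightarrow> complex) set \<Rightarrow> ((complex \<Rightarrow> complex) \<Rightarrow> real) \<Rightarrow>
    ((complex \<Rightarrow> complex) \<Rightarrow> (complex \<Rightarrow> complex)) \<Rightarrow> bool" where
  "bounded_op_on X N S \<longleftrightarrow>
     S ` X \<subseteq> X \<and>
     (\<forall>f\<in>X. \<forall>g\<in>X. S (f + g) = S f + S g) \<and>
     (\<forall>c. \<forall>f\<in>X. S (\<lambda>z. c * f z) = (\<lambda>z. c * S f z)) \<and>
     (\<exists>C. \<forall>f\<in>X. N (S f) \<le> C * N f)"

definition spectrum_on :: "(complex \<Rightarrow> complex) set \<Rightarrow> ((complex \<Rightarrow> complex) \<Rightarrow> real) \<Rightarrow>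
    ((complex \<Rightarrow> complex) \<Rightarrow> (complex \<Rightarrow> complex)) \<Rightarrow> complex set" where
  "spectrum_on X N T = {\<mu>. \<not> (\<exists>S. bounded_op_on X N S \<and>
     (\<forall>f\<in>X. S ((\<lambda>z. \<mu> * f z) - T f) = f \<and> (\<lambda>z. \<mu> * S f z) - T (S f) = f))}"

definition finite_dimensional :: "(complex \<Rightarrow> complex) set \<Rightarrow> bool" where
  "finite_dimensional X \<longleftrightarrow> (\<exists>B. finite B \<and> B \<subseteq> X \<and> cfun.span B = X)"

definition koenigs :: "(complex \<Rightarrow> complex) \<Rightarrow> complex \<Rightarrow> complex \<Rightarrow> complex" where
  "koenigs \<phi> \<alpha> = (THE \<kappa>. \<kappa> \<in> Hol_disc \<and>
     (\<forall>z\<in>unit_disc. \<kappa> (\<phi> z) = deriv \<phi> \<alpha> * \<kappa> z) \<and> deriv \<kappa> \<alpha> = 1)"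

definition koenigs_pow :: "(complex \<Rightarrow> complex) \<Rightarrow> complex \<Rightarrow> nat \<Rightarrow> complex \<Rightarrow> complex" where
  "koenigs_pow \<phi> \<alpha> n = on_disc (\<lambda>z. koenigs \<phi> \<alpha> z ^ n)"

fun koenigs_proj :: "(complex \<Rightarrow> complex) \<Rightarrow> complex \<Rightarrow> nat \<Rightarrow>
    (complex \<Rightarrow> complex) \<Rightarrow> (complex \<Rightarrow> complex)" where
  "koenigs_proj \<phi> \<alpha> 0 f = on_disc (\<lambda>z. f \<alpha> * 1)"
| "koenigs_proj \<phi> \<alpha> (Suc n) f =
     (let g = f - (\<Sum>k<Suc n. koenigs_proj \<phi> \<alpha> k f)
      in (\<lambda>z. 1 / fact (Suc n) * (deriv ^^ Suc n) g \<alpha> * koenigs_pow \<phi> \<alpha> (Suc n) z))"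

definition koenigs_functional :: "(complex \<Rightarrow> complex) \<Rightarrow> complex \<Rightarrow> nat \<Rightarrow>
    (complex \<Rightarrow> complex) \<Rightarrow> complex" where
  "koenigs_functional \<phi> \<alpha> n f =
     (THE c. koenigs_proj \<phi> \<alpha> n f = (\<lambda>z. c * koenigs_pow \<phi> \<alpha> n z))"

end

theory Submission
  imports Defs
begin

text \<open>The functional \<open>\<Psi>\<^sub>n\<close> is the \<open>n\<close>-th coefficient in the expansion of a function in powers of
  the Koenigs eigenfunction at \<open>\<alpha>\<close>: \<open>f - (\<Sum>k<n. \<Psi>\<^sub>k f \<kappa>\<^sup>k)\<close> vanishes to order \<open>n\<close> at \<open>\<alpha>\<close>, and this
  determines the coefficients. Hence \<open>\<Psi>\<^sub>n\<close> is an eigenvector of the adjoint of the composition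
  operator \<open>T\<close> for the eigenvalue \<open>\<lambda>\<^sup>n\<close>, where \<open>\<lambda> = \<phi>'(\<alpha>)\<close> and \<open>0 < \<bar>\<lambda>\<bar> < 1\<close>. If \<open>T\<close> is invertible,
  its adjoint has no eigenvalues close to \<open>0\<close>; if \<open>X\<close> is finite dimensional, it has only finitely
  many eigenvalues. In both cases only finitely many \<open>\<Psi>\<^sub>n\<close> are nonzero on \<open>X\<close>, so \<open>X\<close> consists of
  polynomials in \<open>\<kappa>\<close>; applying the operators \<open>T - \<lambda>\<^sup>m\<close> isolates the single powers of \<open>\<kappa>\<close>.\<close>

subsection \<open>Order of vanishing\<close>

lemma sum_fun_apply: "(\<Sum>i\<in>A. f i) x = (\<Sum>i\<in>A. f i x)"
  for f :: "'b \<Rightarrow> 'c \<Rightarrow> 'd::comm_monoid_add"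
  by (induction A rule: infinite_finite_induct) auto

text \<open>A holomorphic cofactor, rather than a list of vanishing derivatives, encodes a zero of
  order at least \<open>n\<close>: sums and compositions then become algebra on cofactors. Order 0
  means holomorphy on the disc, and the zero function has every order.\<close>

definition vanishes_to :: "complex \<Rightarrow> nat \<Rightarrow> (complex \<Rightarrow> complex) \<Rightarrow> bool" where
  "vanishes_to a n f \<longleftrightarrow>
     (\<exists>h. h holomorphic_on unit_disc \<and> (\<forall>z\<in>unit_disc. f z = (z - a) ^ n * h z))"

text \<open>The difference quotient has a removable singularity at \<open>a\<close>, filled by the
  derivative.\<close>

lemma holomorphic_factor_root:
  assumes "f holomorphic_on unit_disc" "f a = 0"
  obtains g where "g holomorphic_on unit_disc" "\<And>z. f z = (z - a) * g z" "g a = deriv f a"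
proof
  let ?g = "\<lambda>z. if z = a then deriv f a else (f z - f a) / (z - a)"
  show "?g holomorphic_on unit_disc"
    using assms(1) by (rule pole_lemma_open) auto
qed (use assms in auto)

text \<open>In the Leibniz formula at \<open>a\<close> only the term with all \<open>n\<close>
  derivatives on \<open>(z - a) ^ n\<close> survives. This is how leading coefficients are read
  off.\<close>

lemma higher_deriv_vanishing:
  assumes "h holomorphic_on unit_disc" "a \<in> unit_disc"
    and eq: "\<And>z. z \<in> unit_disc \<Longrightarrow> f z = (z - a) ^ n * h z"
  shows "(deriv ^^ n) f a = fact n * h a"
proof -
  have hol: "(\<lambda>z. (z - a) ^ n * h z) holomorphic_on unit_disc"
    using assms by (intro holomorphic_intros)
  have "(deriv ^^ n) f a = (deriv ^^ n) (\<lambda>z. (z - a) ^ n * h z) a"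
    by (rule higher_deriv_transform_within_open[of _ unit_disc])
      (use assms hol holomorphic_transform[OF hol, of f] in auto)
  also have "\<dots> = (\<Sum>i=0..n. of_nat (n choose i) * (deriv ^^ i) (\<lambda>w. (w - a) ^ n) a
       * (deriv ^^ (n - i)) h a)"
    by (rule higher_deriv_mult[of _ unit_disc]) (use assms in \<open>auto intro!: holomorphic_intros\<close>)
  also have "\<dots> = (\<Sum>i\<in>{n}. of_nat (n choose i) * (deriv ^^ i) (\<lambda>w. (w - a) ^ n) a
       * (deriv ^^ (n - i)) h a)"
    by (rule sum.mono_neutral_right) (auto simp: higher_deriv_power)
  also have "\<dots> = fact n * h a"
    by (simp add: higher_deriv_power pochhammer_fact)
  finally show ?thesis .
qed

lemma vanishes_to_Suc_D: "vanishes_to a (Suc n) f \<Longrightarrow> vanishes_to a n f"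
  unfolding vanishes_to_def
proof (elim exE conjE)
  fix h assume "h holomorphic_on unit_disc" "\<forall>z\<in>unit_disc. f z = (z - a) ^ Suc n * h z"
  then show "\<exists>h. h holomorphic_on unit_disc \<and> (\<forall>z\<in>unit_disc. f z = (z - a) ^ n * h z)"
    by (intro exI[of _ "\<lambda>z. (z - a) * h z"]) (auto intro!: holomorphic_intros)
qed

lemma vanishes_to_mono: "vanishes_to a n f \<Longrightarrow> m \<le> n \<Longrightarrow> vanishes_to a m f"
  by (rule inc_induct[of m n "\<lambda>m. vanishes_to a m f"]) (auto intro: vanishes_to_Suc_D)

lemma vanishes_to_cong:
  "vanishes_to a n f \<Longrightarrow> (\<And>z. z \<in> unit_disc \<Longrightarrow> f z = g z) \<Longrightarrow> vanishes_to a n g"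
  unfolding vanishes_to_def by metis

lemma vanishes_to_0: "f holomorphic_on unit_disc \<Longrightarrow> vanishes_to a 0 f"
  unfolding vanishes_to_def by auto

lemma vanishes_to_zero: "vanishes_to a n (\<lambda>z. 0)"
  unfolding vanishes_to_def by (intro exI[of _ "\<lambda>z. 0"]) auto

lemma vanishes_to_add:
  assumes "vanishes_to a n f" "vanishes_to a n g"
  shows "vanishes_to a n (\<lambda>z. f z + g z)"
proof -
  obtain h k where "h holomorphic_on unit_disc" "\<forall>z\<in>unit_disc. f z = (z - a) ^ n * h z"
    "k holomorphic_on unit_disc" "\<forall>z\<in>unit_disc. g z = (z - a) ^ n * k z"
    using assms unfolding vanishes_to_def by auto
  then show ?thesis
    unfolding vanishes_to_def
    by (intro exI[of _ "\<lambda>z. h z + k z"]) (auto intro!: holomorphic_intros simp: algebra_simps)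
qed

lemma vanishes_to_scale:
  assumes "vanishes_to a n f"
  shows "vanishes_to a n (\<lambda>z. c * f z)"
proof -
  obtain h where "h holomorphic_on unit_disc" "\<forall>z\<in>unit_disc. f z = (z - a) ^ n * h z"
    using assms unfolding vanishes_to_def by auto
  then show ?thesis
    unfolding vanishes_to_def
    by (intro exI[of _ "\<lambda>z. c * h z"]) (auto intro!: holomorphic_intros)
qed

lemma vanishes_to_diff:
  assumes "vanishes_to a n f" "vanishes_to a n g"
  shows "vanishes_to a n (\<lambda>z. f z - g z)"
  using vanishes_to_add[OF assms(1) vanishes_to_scale[OF assms(2), of "-1"]] by simp

text \<open>As \<open>a\<close> is a fixed point, \<open>\<phi> z - a\<close> is
  \<open>(z - a) * g z\<close>, so the factor \<open>(\<phi> z - a) ^ n\<close> still contains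
  \<open>(z - a) ^ n\<close>.\<close>

lemma vanishes_to_compose:
  assumes \<phi>: "\<phi> holomorphic_on unit_disc" "\<phi> ` unit_disc \<subseteq> unit_disc" "\<phi> a = a"
    and f: "vanishes_to a n f"
  shows "vanishes_to a n (\<lambda>z. f (\<phi> z))"
proof -
  have "(\<lambda>z. \<phi> z - a) holomorphic_on unit_disc" using \<phi> by (intro holomorphic_intros)
  then obtain g where g: "g holomorphic_on unit_disc" "\<And>z. \<phi> z - a = (z - a) * g z"
    using holomorphic_factor_root[of "\<lambda>z. \<phi> z - a" a] \<phi>(3) by (metis diff_self)
  obtain h where h: "h holomorphic_on unit_disc" "\<forall>z\<in>unit_disc. f z = (z - a) ^ n * h z"
    using f unfolding vanishes_to_def by auto
  have "(\<lambda>z. h (\<phi> z)) holomorphic_on unit_disc"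
    using holomorphic_on_compose_gen[OF \<phi>(1) h(1) \<phi>(2)] by (simp add: o_def)
  moreover have "f (\<phi> z) = (z - a) ^ n * (g z ^ n * h (\<phi> z))" if "z \<in> unit_disc" for z
    using h(2) \<phi>(2) that by (auto simp: image_subset_iff g(2) power_mult_distrib)
  ultimately show ?thesis
    unfolding vanishes_to_def using g
    by (intro exI[of _ "\<lambda>z. g z ^ n * h (\<phi> z)"]) (auto intro!: holomorphic_intros)
qed

text \<open>The derivative is \<open>fact n * h a\<close> for the cofactor \<open>h\<close>, so
  \<open>h\<close> has a root at \<open>a\<close> that can be split off.\<close>

lemma vanishes_to_SucI:
  assumes "vanishes_to a n f" "a \<in> unit_disc" "(deriv ^^ n) f a = 0"
  shows "vanishes_to a (Suc n) f"
proof -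
  obtain h where h: "h holomorphic_on unit_disc" "\<forall>z\<in>unit_disc. f z = (z - a) ^ n * h z"
    using assms unfolding vanishes_to_def by auto
  have "h a = 0"
    using higher_deriv_vanishing[OF h(1) assms(2), of f n] h(2) assms(3) by auto
  then obtain g where "g holomorphic_on unit_disc" "\<And>z. h z = (z - a) * g z"
    using holomorphic_factor_root h(1) by blast
  then show ?thesis
    using h(2) unfolding vanishes_to_def by (intro exI[of _ g]) auto
qed

lemma higher_deriv_vanishes_to_Suc:
  assumes "vanishes_to a (Suc n) f" "a \<in> unit_disc"
  shows "(deriv ^^ n) f a = 0"
proof -
  obtain h where h: "h holomorphic_on unit_disc" "\<forall>z\<in>unit_disc. f z = (z - a) ^ Suc n * h z"
    using assms unfolding vanishes_to_def by auto
  then have "(deriv ^^ n) f a = fact n * ((a - a) * h a)"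
    by (intro higher_deriv_vanishing[OF _ assms(2)]) (auto intro!: holomorphic_intros)
  then show ?thesis by simp
qed

text \<open>All derivatives at \<open>a\<close> vanish, and the identity theorem applies on the
  connected disc.\<close>

lemma vanishes_to_all_imp_zero:
  assumes "f holomorphic_on unit_disc" "a \<in> unit_disc" "\<And>n. vanishes_to a n f" "z \<in> unit_disc"
  shows "f z = 0"
  using assms higher_deriv_vanishes_to_Suc[OF assms(3) assms(2)]
  by (intro holomorphic_fun_eq_0_on_connected[of f unit_disc a]) auto

subsection \<open>Koenigs' theorem\<close>

text \<open>The eigenfunction is the limit of \<open>f\<^sup>n / l\<^sup>n\<close> for \<open>l = f'(0)\<close>. The iterates eventually contract
  by a factor \<open>q\<close> with \<open>q\<^sup>2 < \<bar>l\<bar>\<close>, whereas \<open>f(w) - l w\<close> is quadratic in \<open>w\<close>; so consecutive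
  differences are dominated by a geometric series.\<close>

lemma koenigs_exists_at_0:
  assumes f: "f holomorphic_on unit_disc" "f ` unit_disc \<subseteq> unit_disc" "f 0 = 0"
    and lam: "deriv f 0 \<noteq> 0" "cmod (deriv f 0) < 1"
  obtains K where "K holomorphic_on unit_disc"
    "\<And>z. z \<in> unit_disc \<Longrightarrow> K (f z) = deriv f 0 * K z" "deriv K 0 = 1"
proof -
  define l where "l = deriv f 0"
  have l: "l \<noteq> 0" "0 < cmod l" "cmod l < 1" using lam by (auto simp: l_def)
  have fd: "cmod (f z) < 1" if "cmod z < 1" for z
    using f(2) that by (auto simp: image_subset_iff)
  obtain G where G: "G holomorphic_on unit_disc" "\<And>z. f z = z * G z" "G 0 = l"
    using holomorphic_factor_root[of f 0] f by (auto simp: l_def)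
  \<comment> \<open>Schwarz gives the weak inequality; equality at a nonzero point would make
    \<open>f\<close> a rotation, contradicting \<open>cmod l < 1\<close>.\<close>
  have G1: "cmod (G z) < 1" if z: "cmod z < 1" for z
  proof (cases "z = 0")
    case False
    have "cmod (f z) \<le> cmod z"
      using Schwarz_Lemma(1)[OF f(1,3) fd z] .
    moreover have "cmod (f z) \<noteq> cmod z"
    proof
      assume eq: "cmod (f z) = cmod z"
      obtain b where b: "\<And>z. cmod z < 1 \<Longrightarrow> f z = b * z" "cmod b = 1"
        using Schwarz_Lemma(3)[OF f(1,3) fd z] eq z False by blast
      have "deriv f 0 = deriv (\<lambda>z. b * z) 0"
        by (rule complex_derivative_transform_within_open[of _ unit_disc])
          (use f b in \<open>auto intro!: holomorphic_intros\<close>)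
      then show False using b(2) l by (simp add: l_def)
    qed
    ultimately have "cmod z * cmod (G z) < cmod z * 1"
      by (simp add: G(2) norm_mult)
    then show ?thesis using False by (simp add: mult_less_cancel_left)
  qed (use G l in auto)
  have "(\<lambda>z. G z - l) holomorphic_on unit_disc" using G by (intro holomorphic_intros)
  then obtain H where H: "H holomorphic_on unit_disc" "\<And>z. G z - l = z * H z"
    using holomorphic_factor_root[of "\<lambda>z. G z - l" 0] G(3) by (metis diff_self diff_zero)
  \<comment> \<open>The rate \<open>q\<close> lies strictly between \<open>cmod l\<close> and its
    square root: the lower bound gives \<open>cmod (G z) \<le> q\<close> near 0, the upper one gives
    \<open>q\<^sup>2 / cmod l < 1\<close>.\<close>
  have "cmod l < sqrt (cmod l)"
    using l by (intro real_less_rsqrt) (auto simp: power2_eq_square)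
  then obtain q where q: "cmod l < q" "q < sqrt (cmod l)" using dense by blast
  then have q0: "0 < q" using l by linarith
  have q1: "q < 1" using q(2) l by (smt (verit) real_sqrt_lt_1_iff)
  have "q\<^sup>2 < (sqrt (cmod l))\<^sup>2" using q q0 by (intro power_strict_mono) auto
  then have q2: "q\<^sup>2 < cmod l" using l by simp
  have "isCont G 0" using G(1) 
    by (meson centre_in_ball holomorphic_on_imp_continuous_on continuous_on_eq_continuous_at open_ball zero_less_one)
  then have "\<forall>\<^sub>F z in at 0. cmod (G z) < q"
    using q(1) G(3) by (intro order_tendstoD(2)[of _ "cmod l"]) (auto intro!: tendsto_norm simp: isCont_def)
  then obtain d0 where d0: "d0 > 0" "\<And>z. z \<noteq> 0 \<Longrightarrow> cmod z < d0 \<Longrightarrow> cmod (G z) < q"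
    unfolding eventually_at by auto
  \<comment> \<open>Halving passes from the strict condition to a closed disc; 1/2 keeps that disc
    inside the unit disc.\<close>
  define d where "d = min (d0/2) (1/2)"
  have d: "0 < d" "d < 1" using d0 by (auto simp: d_def)
  have Gq: "cmod (G z) \<le> q" if "cmod z \<le> d" for z
  proof (cases "z = 0")
    case False
    have "cmod z < d0" using that d0(1) by (auto simp: d_def)
    then show ?thesis using d0(2)[of z] False by simp
  qed (use G q in auto)
  have "continuous_on (cball 0 d) H"
    by (intro holomorphic_on_imp_continuous_on holomorphic_on_subset[OF H(1)]) (use d in auto)
  then have "compact (H ` cball 0 d)" by (intro compact_continuous_image) auto
  then obtain C where C: "C > 0" "\<And>z. cmod z \<le> d \<Longrightarrow> cmod (H z) \<le> C"
    using compact_imp_bounded[of "H ` cball 0 d"] unfolding bounded_pos by auto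
  define F where "F n = f ^^ n" for n
  have F0: "F 0 z = z" and FS: "F (Suc n) z = f (F n z)" and FS': "F (Suc n) z = F n (f z)" for n z
    by (auto simp: F_def funpow_swap1)
  have F1: "cmod (F n z) < 1" if "cmod z < 1" for n z
    using that by (induction n) (auto simp: F0 FS fd)
  have Fhol: "F n holomorphic_on unit_disc" for n
  proof (induction n)
    case 0
    then show ?case by (simp add: F_def id_def holomorphic_on_ident)
  next
    case (Suc n)
    have "f \<circ> F n holomorphic_on unit_disc"
      by (rule holomorphic_on_compose_gen[OF Suc f(1)]) (use F1 in auto)
    then show ?case by (simp add: F_def o_def)
  qed
  \<comment> \<open>The increments of \<open>F n z / l ^ n\<close>; their sum telescopes, so
    \<open>K\<close> is the limit of the normalised iterates.\<close>
  define u where "u n z = (F (Suc n) z - l * F n z) / l ^ Suc n" for n z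
  define K where "K z = z + (\<Sum>n. u n z)" for z
  have Ksum: "z + (\<Sum>i<n. u i z) = F n z / l ^ n" for n z
  proof (induction n)
    case (Suc n)
    have "z + (\<Sum>i<Suc n. u i z) = F n z / l ^ n + u n z"
      using Suc by (simp add: add.assoc[symmetric])
    also have "\<dots> = F (Suc n) z / l ^ Suc n"
      using l by (simp add: u_def field_simps)
    finally show ?case .
  qed (simp add: F0)
  have ulim: "uniform_limit (cball 0 r) (\<lambda>n z. F n z / l ^ n) K sequentially" if r: "0 < r" "r < 1" for r
  proof -
    have "continuous_on (cball 0 r) (\<lambda>z. cmod (G z))"
      by (intro continuous_on_norm holomorphic_on_imp_continuous_on holomorphic_on_subset[OF G(1)])
        (use r in auto)
    then obtain x where x: "cmod x \<le> r" "\<And>z. cmod z \<le> r \<Longrightarrow> cmod (G z) \<le> cmod (G x)"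
      using continuous_attains_sup[of "cball 0 r" "\<lambda>z. cmod (G z)"] r by auto
    \<comment> \<open>By compactness \<open>p < 1\<close> contracts all orbits starting in
      \<open>cball 0 r\<close> at a common rate, so a single \<open>N\<close> brings them all within
      distance \<open>d\<close> of 0.\<close>
    define p where "p = cmod (G x)"
    have p: "0 \<le> p" "p < 1" using G1[of x] x(1) r by (auto simp: p_def)
    have Fp: "cmod (F n z) \<le> r \<and> cmod (F n z) \<le> p ^ n" if "cmod z \<le> r" for n z
    proof (induction n)
      case 0
      then show ?case using that r by (auto simp: F0)
    next
      case (Suc n)
      have "cmod (F (Suc n) z) = cmod (F n z) * cmod (G (F n z))"
        by (simp add: FS G(2)[of "F n z"] norm_mult)
      also have "\<dots> \<le> cmod (F n z) * p"
        using Suc x(2)[of "F n z"] by (intro mult_left_mono) (auto simp: p_def)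
      finally have *: "cmod (F (Suc n) z) \<le> cmod (F n z) * p" .
      moreover have "cmod (F n z) * p \<le> r * 1" using Suc p r by (intro mult_mono) auto
      moreover have "cmod (F n z) * p \<le> p ^ n * p" using Suc p by (intro mult_right_mono) auto
      ultimately show ?case by (simp add: mult.commute)
    qed
    obtain N where N: "p ^ N < d" using real_arch_pow_inv[of d p] d p by auto
    have Fq: "cmod (F (N + k) z) \<le> q ^ k * d" if "cmod z \<le> r" for k z
    proof (induction k)
      case 0
      then show ?case using Fp[OF that, of N] N by simp
    next
      case (Suc k)
      have "q ^ k * d \<le> 1 * d"
        using q0 q1 d by (intro mult_right_mono power_le_one) auto
      then have le: "cmod (F (N + k) z) \<le> d" using Suc by simp
      have "cmod (F (N + Suc k) z) = cmod (G (F (N + k) z)) * cmod (F (N + k) z)"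
        by (simp add: FS G(2)[of "F (N + k) z"] norm_mult)
      also have "\<dots> \<le> q * (q ^ k * d)"
        using Suc Gq[OF le] q0 by (intro mult_mono) auto
      finally show ?case by simp
    qed
    \<comment> \<open>For \<open>n = N + k\<close> the increment is at most
      \<open>C * q ^ (2 * k) / cmod l ^ Suc n\<close>. Dividing by \<open>q ^ (2 * N)\<close>
      rewrites this as a geometric sequence in \<open>n\<close>.\<close>
    define M where "M n = C / (q ^ (2 * N) * cmod l) * (q\<^sup>2 / cmod l) ^ n" for n
    have "summable M" unfolding M_def
      using q2 q0 l by (intro summable_mult summable_geometric) auto
    moreover have "cmod (u n z) \<le> M n" if n: "n \<ge> N" and z: "cmod z \<le> r" for n z
    proof -
      define w where "w = F n z"
      obtain k where k: "n = N + k" using n le_Suc_ex by blast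
      have wd: "cmod w \<le> q ^ k * d" using Fq[OF z, of k] by (simp add: w_def k)
      have qk: "q ^ k \<le> 1" using q0 q1 by (simp add: power_le_one)
      have "q ^ k * d \<le> q ^ k * 1" "q ^ k * d \<le> 1 * d"
        using d q0 qk by (intro mult_mono; simp)+
      with wd have w: "cmod w \<le> q ^ k" "cmod w \<le> d" by auto
      \<comment> \<open>The linear part of \<open>f\<close> at 0 cancels and leaves the quadratic
        remainder.\<close>
      have "F (Suc n) z - l * F n z = w * (w * H w)"
        by (simp add: FS G(2)[of "F n z"] w_def H(2)[symmetric] algebra_simps)
      then have "cmod (u n z) = (cmod w)\<^sup>2 * cmod (H w) / cmod l ^ Suc n"
        by (simp add: u_def norm_mult norm_divide norm_power power2_eq_square)
      also have "\<dots> \<le> (q ^ k)\<^sup>2 * C / cmod l ^ Suc n"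
        using w C(2)[of w] q0 by (intro divide_right_mono mult_mono power_mono) auto
      also have "\<dots> = M n"
        unfolding M_def k using q0 l
        by (simp add: field_simps power_add power_mult power2_eq_square power_mult_distrib)
      finally show ?thesis .
    qed
    ultimately have "uniform_limit (cball 0 r) (\<lambda>n z. \<Sum>i<n. u i z) (\<lambda>z. \<Sum>n. u n z) sequentially"
      by (intro Weierstrass_m_test_ev[of _ _ M])
        (auto simp: eventually_sequentially intro!: exI[of _ N])
    then have "uniform_limit (cball 0 r) (\<lambda>n z. z + (\<Sum>i<n. u i z)) (\<lambda>z. z + (\<Sum>n. u n z)) sequentially"
      by (intro uniform_limit_intros)
    then show ?thesis by (simp add: Ksum K_def[abs_def])
  qed
  have Khol: "K holomorphic_on unit_disc"
  proof (rule holomorphic_uniform_sequence[where f = "\<lambda>n z. F n z / l ^ n"])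
    show "(\<lambda>z. F n z / l ^ n) holomorphic_on unit_disc" for n
      using Fhol l by (intro holomorphic_intros) auto
    fix x :: complex assume x: "x \<in> unit_disc"
    \<comment> \<open>Half the distance to the unit circle, so the closed disc around
      \<open>x\<close> stays in a centred disc of radius below 1, where \<open>ulim\<close>
      applies.\<close>
    let ?d = "(1 - cmod x) / 2"
    have sub: "cball x ?d \<subseteq> cball 0 ((1 + cmod x) / 2)"
    proof
      fix y assume "y \<in> cball x ?d"
      then have "cmod (y - x) \<le> ?d" by (simp add: dist_norm norm_minus_commute)
      moreover have "cmod y \<le> cmod x + cmod (y - x)"
        by (metis add.commute diff_add_cancel norm_triangle_ineq)
      ultimately show "y \<in> cball 0 ((1 + cmod x) / 2)" by (simp add: field_simps)
    qed
    have "cball x ?d \<subseteq> unit_disc" 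
    proof
      fix y assume "y \<in> cball x ?d"
      then have "cmod y \<le> (1 + cmod x) / 2" using sub by auto
      then show "y \<in> unit_disc" using x by simp
    qed
    moreover have "uniform_limit (cball x ?d) (\<lambda>n z. F n z / l ^ n) K sequentially"
      by (rule uniform_limit_on_subset[OF ulim sub]) (use x in \<open>auto simp: add_pos_nonneg\<close>)
    ultimately show "\<exists>d>0. cball x d \<subseteq> unit_disc \<and> uniform_limit (cball x d) (\<lambda>n z. F n z / l ^ n) K sequentially"
      using x by (intro exI[of _ ?d]) auto
  qed auto
  have Kpt: "(\<lambda>n. F n z / l ^ n) \<longlonglongrightarrow> K z" if "cmod z < 1" for z
    using tendsto_uniform_limitI[OF ulim[of "(1 + cmod z) / 2"], of z] that
    by (auto simp: add_pos_nonneg)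
  have "K (f z) = l * K z" if z: "z \<in> unit_disc" for z
  proof -
    have "(\<lambda>n. F n (f z) / l ^ n) \<longlonglongrightarrow> K (f z)" using fd z by (intro Kpt) auto
    moreover have "(\<lambda>n. l * (F (Suc n) z / l ^ Suc n)) \<longlonglongrightarrow> l * K z"
      using LIMSEQ_Suc[OF Kpt[of z]] z by (intro tendsto_mult_left) auto
    moreover have "l * (F (Suc n) z / l ^ Suc n) = F n (f z) / l ^ n" for n
      using l by (simp add: FS')
    ultimately show ?thesis using LIMSEQ_unique by auto
  qed
  moreover have "deriv K 0 = 1"
  proof -
    \<comment> \<open>By the chain rule at the fixed point every normalised iterate has derivative 1
      at 0, and uniform convergence carries this to the limit.\<close>
    have Fd: "(F n has_field_derivative l ^ n) (at 0) \<and> F n 0 = 0" for n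
    proof (induction n)
      case 0
      then show ?case by (auto simp: F_def id_def)
    next
      case (Suc n)
      have "(f has_field_derivative l) (at 0)"
        using f(1) holomorphic_derivI[of f unit_disc 0] by (simp add: l_def)
      then have "(f \<circ> F n has_field_derivative l * l ^ n) (at 0)"
        using Suc by (intro DERIV_chain) auto
      then show ?case using Suc f(3) by (simp add: F_def o_def)
    qed
    have "((\<lambda>z. F n z / l ^ n) has_field_derivative l ^ n / l ^ n) (at 0)" for n
      using Fd by (intro DERIV_cdivide) auto
    then have "deriv (\<lambda>z. F n z / l ^ n) 0 = 1" for n
      using l DERIV_imp_deriv by fastforce
    moreover have "(\<lambda>n. deriv (\<lambda>z. F n z / l ^ n) 0) \<longlonglongrightarrow> deriv K 0"
    proof (rule deriv_complex_uniform_limit)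
      show "uniform_limit (ball 0 (1/2)) (\<lambda>n z. F n z / l ^ n) K sequentially"
        by (rule uniform_limit_on_subset[OF ulim[of "1/2"]]) auto
      show "\<forall>\<^sub>F n in sequentially. (\<lambda>z. F n z / l ^ n) holomorphic_on ball 0 (1/2)"
        using l by (intro always_eventually allI holomorphic_intros holomorphic_on_subset[OF Fhol]) auto
    qed auto
    ultimately show ?thesis by (simp add: LIMSEQ_const_iff)
  qed
  ultimately show ?thesis using that Khol by (simp add: l_def)
qed

text \<open>Conjugation by a disc automorphism moves the fixed point to 0 and keeps the multiplier.
  By Schwarz, a multiplier of modulus 1 would make the conjugate a rotation and
  \<open>\<phi>\<close> an automorphism.\<close>

theorem koenigs_exists:
  assumes \<phi>: "\<phi> holomorphic_on unit_disc" "\<phi> ` unit_disc \<subseteq> unit_disc" "\<not> Aut_disc \<phi>"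
    and \<alpha>: "\<alpha> \<in> unit_disc" "\<phi> \<alpha> = \<alpha>" "deriv \<phi> \<alpha> \<noteq> 0"
  shows "cmod (deriv \<phi> \<alpha>) < 1"
    and "\<exists>\<kappa>. \<kappa> holomorphic_on unit_disc \<and>
      (\<forall>z\<in>unit_disc. \<kappa> (\<phi> z) = deriv \<phi> \<alpha> * \<kappa> z) \<and> deriv \<kappa> \<alpha> = 1"
proof -
  define m where "m = Moebius_function 0 \<alpha>"
  define m' where "m' = Moebius_function 0 (-\<alpha>)"
  define \<psi> where "\<psi> = m \<circ> (\<phi> \<circ> m')"
  have mhol: "m holomorphic_on unit_disc" "m' holomorphic_on unit_disc"
    using \<alpha> by (auto simp: m_def m'_def intro!: Moebius_function_holomorphic)
  have md: "m ` unit_disc \<subseteq> unit_disc" "m' ` unit_disc \<subseteq> unit_disc"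
    using \<alpha> by (auto simp: m_def m'_def intro!: Moebius_function_norm_lt_1)
  have mm: "m (m' z) = z" "m' (m z) = z" if "z \<in> unit_disc" for z
    using \<alpha> that by (auto simp: m_def m'_def intro!: Moebius_function_compose)
  have m0: "m \<alpha> = 0" "m' 0 = \<alpha>"
    by (auto simp: m_def m'_def Moebius_function_eq_zero Moebius_function_of_zero)
  have \<phi>m: "(\<phi> \<circ> m') ` unit_disc \<subseteq> unit_disc" using \<phi> md by (force simp: image_subset_iff)
  have \<psi>hol: "\<psi> holomorphic_on unit_disc" unfolding \<psi>_def
    using \<phi> mhol md \<phi>m by (intro holomorphic_on_compose_gen[of _ unit_disc _ unit_disc]) auto
  have \<psi>d: "\<psi> ` unit_disc \<subseteq> unit_disc" using \<phi>m md by (auto simp: \<psi>_def)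
  have \<psi>0: "\<psi> 0 = 0" using m0 \<alpha> by (simp add: \<psi>_def)
  have dm: "(m has_field_derivative deriv m \<alpha>) (at \<alpha>)"
    "(m' has_field_derivative deriv m' 0) (at 0)"
    "(\<phi> has_field_derivative deriv \<phi> \<alpha>) (at \<alpha>)"
    using mhol \<phi> \<alpha> by (auto intro!: holomorphic_derivI[where S = unit_disc])
  have "(m \<circ> m' has_field_derivative deriv m \<alpha> * deriv m' 0) (at 0)"
    using dm by (intro DERIV_chain) (auto simp: m0)
  moreover have "(m \<circ> m' has_field_derivative 1) (at 0)"
    by (rule has_field_derivative_transform_within_open[of id _ _ unit_disc])
      (use mm in \<open>auto simp: id_def\<close>)
  \<comment> \<open>The two Moebius maps are mutually inverse, so their derivatives are reciprocal;
    this preserves the multiplier and later fixes the normalisation.\<close>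
  ultimately have dd: "deriv m \<alpha> * deriv m' 0 = 1" using DERIV_unique by blast
  have "(\<psi> has_field_derivative deriv m \<alpha> * (deriv \<phi> \<alpha> * deriv m' 0)) (at 0)"
    unfolding \<psi>_def using dm \<alpha> by (intro DERIV_chain) (auto simp: m0)
  then have d\<psi>: "deriv \<psi> 0 = deriv \<phi> \<alpha>"
    using DERIV_imp_deriv dd by (metis mult.left_commute mult.right_neutral)
  have \<psi>m: "\<phi> z = m' (\<psi> (m z))" if "z \<in> unit_disc" for z
    using mm[of z] mm[of "\<phi> z"] \<phi> that by (auto simp: \<psi>_def image_subset_iff)
  have nd: "cmod (\<psi> z) < 1" if "cmod z < 1" for z
    using \<psi>d that by (auto simp: image_subset_iff)
  show lt: "cmod (deriv \<phi> \<alpha>) < 1"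
  proof (rule ccontr)
    assume "\<not> cmod (deriv \<phi> \<alpha>) < 1"
    then have "cmod (deriv \<psi> 0) = 1"
      using Schwarz_Lemma(2)[OF \<psi>hol \<psi>0 nd, of 0] d\<psi> by simp
    then obtain b where b: "\<And>z. cmod z < 1 \<Longrightarrow> \<psi> z = b * z" "cmod b = 1"
      using Schwarz_Lemma(3)[OF \<psi>hol \<psi>0 nd, of 0] by auto
    \<comment> \<open>The inverse of \<open>\<phi>\<close>: the inverse rotation, conjugated
      back.\<close>
    define \<eta> where "\<eta> = m' \<circ> ((\<lambda>z. z / b) \<circ> m)"
    have rd: "((\<lambda>z. z / b) \<circ> m) ` unit_disc \<subseteq> unit_disc"
      using md b(2) by (auto simp: norm_divide)
    have b0: "b \<noteq> 0" using b(2) by auto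
    have "\<eta> holomorphic_on unit_disc" unfolding \<eta>_def
      using mhol md rd b0
      by (intro holomorphic_on_compose_gen[of _ unit_disc _ unit_disc] holomorphic_intros) auto
    moreover have "\<eta> ` unit_disc \<subseteq> unit_disc" using rd md by (auto simp: \<eta>_def)
    moreover have "\<eta> (\<phi> z) = z \<and> \<phi> (\<eta> z) = z" if z: "z \<in> unit_disc" for z
    proof
      have mz: "m z \<in> unit_disc" using md z by (simp add: image_subset_iff)
      have "m (\<phi> z) = \<psi> (m z)" using mm z by (simp add: \<psi>_def)
      also have "\<dots> = b * m z" using b mz by simp
      finally show "\<eta> (\<phi> z) = z" using mm z b0 by (simp add: \<eta>_def)
      have w: "m z / b \<in> unit_disc" using mz b(2) by (simp add: norm_divide)
      then have "\<eta> z \<in> unit_disc" using md by (simp add: \<eta>_def image_subset_iff)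
      then have "\<phi> (\<eta> z) = m' (\<psi> (m (\<eta> z)))" by (rule \<psi>m)
      also have "m (\<eta> z) = m z / b" using mm w by (simp add: \<eta>_def)
      also have "\<psi> \<dots> = m z" using b w b0 by simp
      finally show "\<phi> (\<eta> z) = z" using mm z by simp
    qed
    ultimately have "Aut_disc \<phi>" using \<phi> unfolding Aut_disc_def by blast
    then show False using \<phi> by simp
  qed
  obtain K where K: "K holomorphic_on unit_disc"
    "\<And>z. z \<in> unit_disc \<Longrightarrow> K (\<psi> z) = deriv \<phi> \<alpha> * K z" "deriv K 0 = 1"
    using koenigs_exists_at_0[OF \<psi>hol \<psi>d \<psi>0] lt \<alpha> unfolding d\<psi> by blast
  \<comment> \<open>The factor \<open>deriv m' 0\<close> is the reciprocal of
    \<open>deriv m \<alpha>\<close> and normalises the derivative at \<alpha> to 1.\<close>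
  define \<kappa> where "\<kappa> z = deriv m' 0 * (K \<circ> m) z" for z
  have "K \<circ> m holomorphic_on unit_disc"
    using mhol md K by (intro holomorphic_on_compose_gen[of _ unit_disc _ unit_disc]) auto
  then have "\<kappa> holomorphic_on unit_disc"
    unfolding \<kappa>_def[abs_def] by (intro holomorphic_intros)
  moreover have "\<kappa> (\<phi> z) = deriv \<phi> \<alpha> * \<kappa> z" if "z \<in> unit_disc" for z
  proof -
    have mz: "m z \<in> unit_disc" using md that by (simp add: image_subset_iff)
    have "m (\<phi> z) = \<psi> (m z)" using mm that by (simp add: \<psi>_def)
    then show ?thesis using K(2)[OF mz] by (simp add: \<kappa>_def)
  qed
  moreover have "deriv \<kappa> \<alpha> = 1"
  proof (rule DERIV_imp_deriv)
    have "(K has_field_derivative 1) (at (m \<alpha>))"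
      using holomorphic_derivI[OF K(1), of 0] K(3) by (simp add: m0)
    then have "(K \<circ> m has_field_derivative 1 * deriv m \<alpha>) (at \<alpha>)"
      using dm by (intro DERIV_chain) auto
    then have "(\<kappa> has_field_derivative deriv m' 0 * (1 * deriv m \<alpha>)) (at \<alpha>)"
      unfolding \<kappa>_def[abs_def] by (rule DERIV_cmult)
    then show "(\<kappa> has_field_derivative 1) (at \<alpha>)"
      using dd by (simp add: mult.commute)
  qed
  ultimately show "\<exists>\<kappa>. \<kappa> holomorphic_on unit_disc \<and>
      (\<forall>z\<in>unit_disc. \<kappa> (\<phi> z) = deriv \<phi> \<alpha> * \<kappa> z) \<and> deriv \<kappa> \<alpha> = 1" by blast
qed

section \<open>The space of holomorphic functions on the disc and composition operators\<close>

lemma Hol_disc_holomorphic: "f \<in> Hol_disc \<Longrightarrow> f holomorphic_on unit_disc"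
  by (simp add: Hol_disc_def)

lemma on_disc_in_Hol_disc: "f holomorphic_on unit_disc \<Longrightarrow> on_disc f \<in> Hol_disc"
  by (auto simp: Hol_disc_def on_disc_def elim: holomorphic_transform)

lemma Hol_disc_ext:
  "f \<in> Hol_disc \<Longrightarrow> g \<in> Hol_disc \<Longrightarrow> (\<And>z. z \<in> unit_disc \<Longrightarrow> f z = g z) \<Longrightarrow> f = g"
proof
  fix z
  assume "f \<in> Hol_disc" "g \<in> Hol_disc" "\<And>z. z \<in> unit_disc \<Longrightarrow> f z = g z"
  then show "f z = g z"
    by (cases "z \<in> unit_disc") (simp_all add: Hol_disc_def)
qed

lemma Hol_disc_scale: "f \<in> Hol_disc \<Longrightarrow> (\<lambda>z. c * f z) \<in> Hol_disc"
  by (auto simp: Hol_disc_def intro!: holomorphic_intros)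

lemma Hol_disc_add: "f \<in> Hol_disc \<Longrightarrow> g \<in> Hol_disc \<Longrightarrow> f + g \<in> Hol_disc"
  by (auto simp: Hol_disc_def plus_fun_def intro!: holomorphic_intros)

lemma Hol_disc_combination:
  "(\<And>k. k \<in> A \<Longrightarrow> f k \<in> Hol_disc) \<Longrightarrow> (\<lambda>z. \<Sum>k\<in>A. c k * f k z) \<in> Hol_disc"
  by (auto simp: Hol_disc_def intro!: holomorphic_intros)

lemma Hol_disc_diff: "f \<in> Hol_disc \<Longrightarrow> g \<in> Hol_disc \<Longrightarrow> (\<lambda>z. f z - g z) \<in> Hol_disc"
  by (auto simp: Hol_disc_def intro!: holomorphic_intros)

lemma comp_op_combination:
  "comp_op \<phi> (\<lambda>z. \<Sum>k\<in>A. c k * f k z) = (\<lambda>z. \<Sum>k\<in>A. c k * comp_op \<phi> (f k) z)"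
  by (auto simp: comp_op_def on_disc_def)

section \<open>The multiplier and uniqueness of the eigenfunction\<close>

locale koenigs_map =
  fixes \<phi> :: "complex \<Rightarrow> complex" and \<alpha> :: complex
  assumes hol: "\<phi> holomorphic_on unit_disc" and maps: "\<phi> ` unit_disc \<subseteq> unit_disc"
    and not_Aut: "\<not> Aut_disc \<phi>"
    and \<alpha>: "\<alpha> \<in> unit_disc" and fixpoint: "\<phi> \<alpha> = \<alpha>" and deriv_nz: "deriv \<phi> \<alpha> \<noteq> 0"
begin

abbreviation lam :: complex where "lam \<equiv> deriv \<phi> \<alpha>"
abbreviation \<kappa> :: "complex \<Rightarrow> complex" where "\<kappa> \<equiv> koenigs \<phi> \<alpha>"
abbreviation \<kappa>p :: "nat \<Rightarrow> complex \<Rightarrow> complex" where "\<kappa>p \<equiv> koenigs_pow \<phi> \<alpha>"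
abbreviation \<Psi> :: "nat \<Rightarrow> (complex \<Rightarrow> complex) \<Rightarrow> complex" where
  "\<Psi> \<equiv> koenigs_functional \<phi> \<alpha>"

lemma norm_lam: "cmod lam < 1"
  using koenigs_exists(1)[OF hol maps not_Aut \<alpha> fixpoint deriv_nz] .

text \<open>The moduli of the powers decrease strictly, as \<open>0 < cmod lam < 1\<close>. Hence
  the eigenvalues \<open>lam ^ n\<close> are pairwise distinct.\<close>

lemma lam_pow_inject: "lam ^ m = lam ^ n \<longleftrightarrow> m = n"
proof
  assume "lam ^ m = lam ^ n"
  then have "cmod lam ^ m = cmod lam ^ n" by (metis norm_power)
  then show "m = n"
    using power_strict_decreasing_iff[of "cmod lam"] deriv_nz norm_lam
    by (metis linorder_neq_iff zero_less_norm_iff)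
qed auto

lemma maps_to: "z \<in> unit_disc \<Longrightarrow> \<phi> z \<in> unit_disc"
  using maps by (simp add: image_subset_iff)

lemma comp_op_in_Hol_disc: "f \<in> Hol_disc \<Longrightarrow> comp_op \<phi> f \<in> Hol_disc"
  unfolding comp_op_def using hol maps
  by (intro on_disc_in_Hol_disc holomorphic_on_compose_gen[of _ _ _ unit_disc])
    (auto simp: Hol_disc_def)

text \<open>An eigenfunction for \<open>lam\<close> that vanishes to order two at \<open>\<alpha>\<close> vanishes to every order,
  because a leading coefficient of order \<open>n\<close> is multiplied by \<open>lam ^ n\<close> under composition.\<close>

lemma koenigs_unique:
  assumes f: "f holomorphic_on unit_disc" "\<And>z. z \<in> unit_disc \<Longrightarrow> f (\<phi> z) = lam * f z"
    and d: "deriv f \<alpha> = 0" and z: "z \<in> unit_disc"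
  shows "f z = 0"
proof -
  have lam1: "lam \<noteq> 1" using norm_lam by auto
  have f\<alpha>: "f \<alpha> = 0" using f(2)[OF \<alpha>] lam1 by (simp add: fixpoint)
  have "vanishes_to \<alpha> 0 f" by (rule vanishes_to_0[OF f(1)])
  then have "vanishes_to \<alpha> (Suc 0) f" by (rule vanishes_to_SucI) (use \<alpha> f\<alpha> in auto)
  then have v2: "vanishes_to \<alpha> 2 f" 
    using vanishes_to_SucI[of \<alpha> 1 f] \<alpha> d by (simp add: numeral_2_eq_2)
  have "vanishes_to \<alpha> n f" if "n \<ge> 2" for n
    using that
  proof (induction n rule: dec_induct)
    case base
    then show ?case by (rule v2)
  next
    case (step n)
    obtain h where h: "h holomorphic_on unit_disc" "\<And>z. z \<in> unit_disc \<Longrightarrow> f z = (z - \<alpha>) ^ n * h z"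
      using step unfolding vanishes_to_def by auto
    have \<phi>h: "(\<lambda>z. \<phi> z - \<alpha>) holomorphic_on unit_disc" using hol by (intro holomorphic_intros)
    obtain g where g: "g holomorphic_on unit_disc" "\<And>z. \<phi> z - \<alpha> = (z - \<alpha>) * g z"
        "g \<alpha> = deriv (\<lambda>z. \<phi> z - \<alpha>) \<alpha>"
      using holomorphic_factor_root[OF \<phi>h, of \<alpha>] by (metis fixpoint diff_self)
    have "deriv (\<lambda>z. \<phi> z - \<alpha>) \<alpha> = lam"
      using holomorphic_on_imp_differentiable_at[OF hol _ \<alpha>] by simp
    with g have g\<alpha>: "g \<alpha> = lam" by simp
    have h\<phi>: "(\<lambda>z. h (\<phi> z)) holomorphic_on unit_disc"
      using holomorphic_on_compose_gen[OF hol h(1) maps] by (simp add: o_def)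
    have eq: "f (\<phi> z) = (z - \<alpha>) ^ n * (g z ^ n * h (\<phi> z))" if "z \<in> unit_disc" for z
      using h(2)[OF maps_to[OF that]] by (simp add: g(2)[of z] power_mult_distrib)
    \<comment> \<open>The leading coefficient of the composition is computed twice: composition
      gives the factor \<open>lam ^ n\<close>, the eigenvalue equation the factor
      \<open>lam\<close>. These differ as \<open>n \<ge> 2\<close>.\<close>
    have "(deriv ^^ n) (\<lambda>z. f (\<phi> z)) \<alpha> = fact n * (g \<alpha> ^ n * h (\<phi> \<alpha>))"
      by (rule higher_deriv_vanishing[OF _ \<alpha>]) (use eq g h\<phi> in \<open>auto intro!: holomorphic_intros\<close>)
    moreover have "(deriv ^^ n) (\<lambda>z. f (\<phi> z)) \<alpha> = fact n * (lam * h \<alpha>)"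
      by (rule higher_deriv_vanishing[OF _ \<alpha>]) (use f(2) h in \<open>auto intro!: holomorphic_intros\<close>)
    ultimately have "lam ^ n * h \<alpha> = lam ^ 1 * h \<alpha>"
      by (metis fixpoint g\<alpha> fact_nonzero mult_left_cancel power_one_right)
    moreover have "lam ^ n \<noteq> lam ^ 1"
      using lam_pow_inject[of n 1] step by simp
    ultimately have "h \<alpha> = 0" using mult_right_cancel by blast
    then have "(deriv ^^ n) f \<alpha> = 0"
      using higher_deriv_vanishing[OF h(1) \<alpha> h(2)] by simp
    then show ?case by (rule vanishes_to_SucI[OF step.IH \<alpha>])
  qed
  then have "vanishes_to \<alpha> n f" for n
    using vanishes_to_mono[of \<alpha> "n + 2" f n] by simp
  then show ?thesis by (rule vanishes_to_all_imp_zero[OF f(1) \<alpha> _ z])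
qed

text \<open>Justifies the definite description: existence by cutting off an eigenfunction outside
  the disc, uniqueness by \<open>koenigs_unique\<close> applied to a difference, whose derivative at
  \<alpha> is 0.\<close>

lemma koenigs_props:
  shows koenigs_in_Hol_disc: "\<kappa> \<in> Hol_disc"
    and koenigs_eigen: "z \<in> unit_disc \<Longrightarrow> \<kappa> (\<phi> z) = lam * \<kappa> z"
    and deriv_koenigs: "deriv \<kappa> \<alpha> = 1"
proof -
  let ?P = "\<lambda>\<kappa>. \<kappa> \<in> Hol_disc \<and> (\<forall>z\<in>unit_disc. \<kappa> (\<phi> z) = lam * \<kappa> z) \<and> deriv \<kappa> \<alpha> = 1"
  obtain K where K: "K holomorphic_on unit_disc"
    "\<And>z. z \<in> unit_disc \<Longrightarrow> K (\<phi> z) = lam * K z" "deriv K \<alpha> = 1"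
    using koenigs_exists(2)[OF hol maps not_Aut \<alpha> fixpoint deriv_nz] by blast
  have "deriv (on_disc K) \<alpha> = deriv K \<alpha>"
    using K on_disc_in_Hol_disc[OF K(1)] \<alpha>
    by (intro complex_derivative_transform_within_open[of _ unit_disc])
      (auto simp: Hol_disc_def on_disc_def)
  then have P: "?P (on_disc K)"
    using K on_disc_in_Hol_disc[OF K(1)] maps_to by (auto simp: on_disc_def)
  have "L = on_disc K" if L: "?P L" for L
  proof (rule Hol_disc_ext)
    show "L \<in> Hol_disc" "on_disc K \<in> Hol_disc" using L P by auto
    fix z assume z: "z \<in> unit_disc"
    have LK: "L holomorphic_on unit_disc" "on_disc K holomorphic_on unit_disc"
      using L P by (auto simp: Hol_disc_def)
    have "(\<lambda>z. L z - on_disc K z) z = 0"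
    proof (rule koenigs_unique[OF _ _ _ z])
      show "(\<lambda>z. L z - on_disc K z) holomorphic_on unit_disc"
        using LK by (intro holomorphic_intros)
      show "L (\<phi> z) - on_disc K (\<phi> z) = lam * (L z - on_disc K z)" if "z \<in> unit_disc" for z
        using L P that by (auto simp: algebra_simps)
      show "deriv (\<lambda>z. L z - on_disc K z) \<alpha> = 0"
        using L P LK \<alpha> holomorphic_on_imp_differentiable_at[OF _ open_ball \<alpha>]
        by (subst deriv_diff) auto
    qed
    then show "L z = on_disc K z" by simp
  qed
  then have "\<exists>!K. ?P K" using P by blast
  then have "?P \<kappa>" unfolding koenigs_def by (rule theI')
  then show "\<kappa> \<in> Hol_disc" "z \<in> unit_disc \<Longrightarrow> \<kappa> (\<phi> z) = lam * \<kappa> z" "deriv \<kappa> \<alpha> = 1" by auto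
qed

subsection \<open>Expansion in powers of the Koenigs eigenfunction\<close>

lemma koenigs_pow_in_Hol_disc: "\<kappa>p n \<in> Hol_disc"
  unfolding koenigs_pow_def
  by (intro on_disc_in_Hol_disc holomorphic_intros Hol_disc_holomorphic koenigs_in_Hol_disc)

lemma comp_op_koenigs_pow: "comp_op \<phi> (\<kappa>p n) = (\<lambda>z. lam ^ n * \<kappa>p n z)"
  using maps_to
  by (auto simp: comp_op_def koenigs_pow_def on_disc_def koenigs_eigen power_mult_distrib)

text \<open>The eigenvalue equation at \<alpha> forces \<open>\<kappa> \<alpha> = 0\<close>, and the
  normalised derivative makes the cofactor of \<open>\<kappa>\<close> equal to 1 there.\<close>

lemma koenigs_pow_factor:
  obtains h where "h holomorphic_on unit_disc" "\<And>z. z \<in> unit_disc \<Longrightarrow> \<kappa>p n z = (z - \<alpha>) ^ n * h z"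
    "h \<alpha> = 1"
proof -
  have "\<kappa> \<alpha> = lam * \<kappa> \<alpha>" using koenigs_eigen[OF \<alpha>] by (simp add: fixpoint)
  then have "\<kappa> \<alpha> = 0" using norm_lam by auto
  then obtain k where k: "k holomorphic_on unit_disc" "\<And>z. \<kappa> z = (z - \<alpha>) * k z" "k \<alpha> = 1"
    using holomorphic_factor_root[of \<kappa> \<alpha>] koenigs_in_Hol_disc deriv_koenigs
    by (metis Hol_disc_holomorphic)
  show ?thesis
    by (rule that[of "\<lambda>z. k z ^ n"])
      (use k in \<open>auto intro!: holomorphic_intros simp: koenigs_pow_def on_disc_def power_mult_distrib\<close>)
qed

lemma vanishes_to_koenigs_pow: "vanishes_to \<alpha> n (\<kappa>p n)"
  unfolding vanishes_to_def by (metis koenigs_pow_factor)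

lemma higher_deriv_koenigs_pow: "(deriv ^^ n) (\<lambda>z. c * \<kappa>p n z) \<alpha> = c * fact n"
proof -
  obtain h where h: "h holomorphic_on unit_disc" "h \<alpha> = 1"
    "\<And>z. z \<in> unit_disc \<Longrightarrow> \<kappa>p n z = (z - \<alpha>) ^ n * h z"
    using koenigs_pow_factor by blast
  have "(deriv ^^ n) (\<lambda>z. c * \<kappa>p n z) \<alpha> = fact n * (c * h \<alpha>)"
    by (rule higher_deriv_vanishing) (use h \<alpha> in \<open>auto intro!: holomorphic_intros\<close>)
  then show ?thesis using h by simp
qed

text \<open>The \<open>n\<close>-th derivative at \<alpha> recovers the scalar, so the description
  defining \<open>\<Psi> n\<close> has at most one solution.\<close>

lemma koenigs_pow_cancel: "(\<lambda>z. c * \<kappa>p n z) = (\<lambda>z. d * \<kappa>p n z) \<longleftrightarrow> c = d"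
  by (metis higher_deriv_koenigs_pow fact_nonzero mult_right_cancel)

lemma koenigs_functional_aux:
  "koenigs_proj \<phi> \<alpha> n f = (\<lambda>z. \<Psi> n f * \<kappa>p n z) \<and>
   \<Psi> n f = (deriv ^^ n) (f - (\<Sum>k<n. koenigs_proj \<phi> \<alpha> k f)) \<alpha> / fact n"
proof -
  let ?c = "(deriv ^^ n) (f - (\<Sum>k<n. koenigs_proj \<phi> \<alpha> k f)) \<alpha> / fact n"
  have p: "koenigs_proj \<phi> \<alpha> n f = (\<lambda>z. ?c * \<kappa>p n z)"
    \<comment> \<open>For \<open>n = 0\<close> the power is the constant 1 on the disc and the
      derivative of order 0 is the value at \<alpha>.\<close>
    by (cases n) (auto simp: koenigs_pow_def on_disc_def Let_def fun_eq_iff simp del: fact_Suc sum.lessThan_Suc)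
  have "\<Psi> n f = ?c"
    unfolding koenigs_functional_def p koenigs_pow_cancel by simp
  then show ?thesis using p by simp
qed

text \<open>A recursion for the coefficients that no longer mentions the projections.\<close>

lemma koenigs_functional_eq:
  "\<Psi> n f = (deriv ^^ n) (\<lambda>z. f z - (\<Sum>k<n. \<Psi> k f * \<kappa>p k z)) \<alpha> / fact n"
proof -
  have "f - (\<Sum>k<n. koenigs_proj \<phi> \<alpha> k f) = (\<lambda>z. f z - (\<Sum>k<n. \<Psi> k f * \<kappa>p k z))"
    by (auto simp: fun_eq_iff sum_fun_apply koenigs_functional_aux[THEN conjunct1])
  then show ?thesis using koenigs_functional_aux by metis
qed

text \<open>By the recursion, subtracting \<open>\<Psi> n f * \<kappa>p n z\<close> cancels exactly
  the \<open>n\<close>-th derivative at \<alpha>, which raises the order by one.\<close>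

lemma vanishes_to_koenigs_remainder:
  assumes "f \<in> Hol_disc"
  shows "vanishes_to \<alpha> n (\<lambda>z. f z - (\<Sum>k<n. \<Psi> k f * \<kappa>p k z))"
proof (induction n)
  case 0
  then show ?case using assms by (auto intro: vanishes_to_0 Hol_disc_holomorphic)
next
  case (Suc n)
  let ?r = "\<lambda>z. f z - (\<Sum>k<n. \<Psi> k f * \<kappa>p k z)"
  have r: "?r holomorphic_on unit_disc" "(\<lambda>z. \<Psi> n f * \<kappa>p n z) holomorphic_on unit_disc"
    using assms koenigs_pow_in_Hol_disc by (auto simp: Hol_disc_def intro!: holomorphic_intros)
  have "vanishes_to \<alpha> (Suc n) (\<lambda>z. ?r z - \<Psi> n f * \<kappa>p n z)"
  proof (rule vanishes_to_SucI[OF _ \<alpha>])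
    show "vanishes_to \<alpha> n (\<lambda>z. ?r z - \<Psi> n f * \<kappa>p n z)"
      by (intro vanishes_to_diff Suc vanishes_to_scale vanishes_to_koenigs_pow)
    show "(deriv ^^ n) (\<lambda>z. ?r z - \<Psi> n f * \<kappa>p n z) \<alpha> = 0"
      unfolding higher_deriv_diff[OF r open_ball \<alpha>, of n] higher_deriv_koenigs_pow
      by (subst koenigs_functional_eq) simp
  qed
  then show ?case by (simp add: algebra_simps)
qed

text \<open>Dropping the top term lowers the order by at most one, so the induction hypothesis kills
  the other coefficients; the top term alone then vanishes to order \<open>n + 1\<close>, although
  \<open>\<kappa>p n\<close> has exact order \<open>n\<close>.\<close>

lemma koenigs_pow_independent:
  "vanishes_to \<alpha> n (\<lambda>z. \<Sum>k<n. a k * \<kappa>p k z) \<Longrightarrow> k < n \<Longrightarrow> a k = 0"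
proof (induction n arbitrary: k)
  case (Suc n)
  have "vanishes_to \<alpha> n (\<lambda>z. (\<Sum>k<Suc n. a k * \<kappa>p k z) - a n * \<kappa>p n z)"
    by (intro vanishes_to_diff vanishes_to_Suc_D[OF Suc.prems(1)] vanishes_to_scale
        vanishes_to_koenigs_pow)
  then have "vanishes_to \<alpha> n (\<lambda>z. \<Sum>k<n. a k * \<kappa>p k z)" by simp
  then have a0: "a k = 0" if "k < n" for k using Suc.IH that by blast
  then have "vanishes_to \<alpha> (Suc n) (\<lambda>z. a n * \<kappa>p n z)" using Suc.prems(1) by simp
  then have "a n * fact n = 0"
    using higher_deriv_vanishes_to_Suc[OF _ \<alpha>] higher_deriv_koenigs_pow by metis
  then have "a n = 0" by simp
  with a0 Suc.prems(2) show ?case by (cases "k = n") auto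
qed auto

text \<open>Two remainders differ by a combination of powers below \<open>n\<close> that vanishes to
  order \<open>n\<close>. The rules for \<open>\<Psi>\<close> below come from exhibiting
  coefficients with a small remainder.\<close>

lemma koenigs_functional_unique:
  assumes "f \<in> Hol_disc" "vanishes_to \<alpha> n (\<lambda>z. f z - (\<Sum>k<n. a k * \<kappa>p k z))" "k < n"
  shows "\<Psi> k f = a k"
proof -
  have "vanishes_to \<alpha> n (\<lambda>z. (f z - (\<Sum>k<n. a k * \<kappa>p k z)) - (f z - (\<Sum>k<n. \<Psi> k f * \<kappa>p k z)))"
    by (intro vanishes_to_diff assms vanishes_to_koenigs_remainder)
  then have "vanishes_to \<alpha> n (\<lambda>z. \<Sum>k<n. (\<Psi> k f - a k) * \<kappa>p k z)"
    by (simp add: algebra_simps sum_subtractf)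
  from koenigs_pow_independent[OF this assms(3)] show ?thesis by simp
qed

section \<open>Linearity, composition rule and biorthogonality of the functionals\<close>

lemma koenigs_functional_add:
  assumes "f \<in> Hol_disc" "g \<in> Hol_disc"
  shows "\<Psi> n (f + g) = \<Psi> n f + \<Psi> n g"
proof (rule koenigs_functional_unique[of _ "Suc n"])
  show "f + g \<in> Hol_disc" using assms by (rule Hol_disc_add)
  have "vanishes_to \<alpha> (Suc n) (\<lambda>z. (f z - (\<Sum>k<Suc n. \<Psi> k f * \<kappa>p k z))
      + (g z - (\<Sum>k<Suc n. \<Psi> k g * \<kappa>p k z)))"
    by (intro vanishes_to_add assms vanishes_to_koenigs_remainder)
  then show "vanishes_to \<alpha> (Suc n) (\<lambda>z. (f + g) z - (\<Sum>k<Suc n. (\<Psi> k f + \<Psi> k g) * \<kappa>p k z))"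
    by (simp add: algebra_simps sum.distrib del: sum.lessThan_Suc)
qed auto

lemma koenigs_functional_scale:
  assumes "f \<in> Hol_disc"
  shows "\<Psi> n (\<lambda>z. c * f z) = c * \<Psi> n f"
proof (rule koenigs_functional_unique[of _ "Suc n"])
  show "(\<lambda>z. c * f z) \<in> Hol_disc" using assms by (rule Hol_disc_scale)
  have "vanishes_to \<alpha> (Suc n) (\<lambda>z. c * (f z - (\<Sum>k<Suc n. \<Psi> k f * \<kappa>p k z)))"
    by (intro vanishes_to_scale assms vanishes_to_koenigs_remainder)
  then show "vanishes_to \<alpha> (Suc n) (\<lambda>z. c * f z - (\<Sum>k<Suc n. (c * \<Psi> k f) * \<kappa>p k z))"
    by (simp add: algebra_simps sum_distrib_left del: sum.lessThan_Suc)
qed auto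

lemma koenigs_functional_combination:
  assumes "\<And>k. k \<in> A \<Longrightarrow> f k \<in> Hol_disc"
  shows "\<Psi> n (\<lambda>z. \<Sum>k\<in>A. c k * f k z) = (\<Sum>k\<in>A. c k * \<Psi> n (f k))"
  using assms
proof (induction A rule: infinite_finite_induct)
  case (insert x A)
  have "(\<lambda>z. \<Sum>k\<in>insert x A. c k * f k z) = (\<lambda>z. c x * f x z) + (\<lambda>z. \<Sum>k\<in>A. c k * f k z)"
    using insert by auto
  then show ?case using insert
    by (simp add: koenigs_functional_add koenigs_functional_scale Hol_disc_scale
        Hol_disc_combination)
\<comment> \<open>Empty and infinite index sets give the zero function, whose coefficients vanish by
  scaling with 0.\<close>
qed (use koenigs_functional_scale[of "\<lambda>z. 0" n 0] in \<open>auto simp: Hol_disc_def\<close>)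

text \<open>Composing the remainder with \<open>\<phi>\<close> keeps its order and multiplies each
  \<open>\<kappa>p k\<close> by \<open>lam ^ k\<close>.\<close>

lemma koenigs_functional_comp_op:
  assumes "f \<in> Hol_disc"
  shows "\<Psi> n (comp_op \<phi> f) = lam ^ n * \<Psi> n f"
proof (rule koenigs_functional_unique[of _ "Suc n"])
  show "comp_op \<phi> f \<in> Hol_disc" using assms by (rule comp_op_in_Hol_disc)
  have eq: "\<kappa>p k (\<phi> z) = lam ^ k * \<kappa>p k z" if "z \<in> unit_disc" for k z
    using that maps_to by (auto simp: koenigs_pow_def on_disc_def koenigs_eigen power_mult_distrib)
  have "vanishes_to \<alpha> (Suc n) (\<lambda>z. f (\<phi> z) - (\<Sum>k<Suc n. \<Psi> k f * \<kappa>p k (\<phi> z)))"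
    by (rule vanishes_to_compose[OF hol maps fixpoint vanishes_to_koenigs_remainder[OF assms]])
  then show "vanishes_to \<alpha> (Suc n)
      (\<lambda>z. comp_op \<phi> f z - (\<Sum>k<Suc n. (lam ^ k * \<Psi> k f) * \<kappa>p k z))"
    by (rule vanishes_to_cong)
      (simp add: eq comp_op_def on_disc_def algebra_simps del: sum.lessThan_Suc)
qed auto

text \<open>For \<open>m \<le> n\<close> the remainder is zero; for \<open>m > n\<close> it is
  \<open>\<kappa>p m\<close> itself, which vanishes to order \<open>m\<close>.\<close>

lemma koenigs_functional_koenigs_pow: "\<Psi> n (\<kappa>p m) = (if n = m then 1 else 0)"
proof (rule koenigs_functional_unique[of _ "Suc n"])
  let ?r = "\<lambda>z. \<kappa>p m z - (\<Sum>k<Suc n. (if k = m then 1 else 0) * \<kappa>p k z)"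
  have s: "(\<Sum>k<Suc n. (if k = m then 1 else 0) * \<kappa>p k z) = (if m < Suc n then \<kappa>p m z else 0)" for z
    by (simp add: if_distrib[of "\<lambda>c. c * _"] sum.delta del: sum.lessThan_Suc cong: if_cong)
  show "vanishes_to \<alpha> (Suc n) ?r"
  proof (cases "m < Suc n")
    case True
    then show ?thesis unfolding s by (simp add: vanishes_to_zero)
  next
    case False
    then show ?thesis unfolding s
      using vanishes_to_mono[OF vanishes_to_koenigs_pow, of "Suc n" m] by simp
  qed
qed (auto simp: koenigs_pow_in_Hol_disc)

lemma koenigs_functional_zero_imp_zero:
  assumes f: "f \<in> Hol_disc" and "\<And>n. \<Psi> n f = 0"
  shows "f = (\<lambda>z. 0)"
proof (rule Hol_disc_ext)
  have "vanishes_to \<alpha> n f" for n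
    using vanishes_to_koenigs_remainder[OF f, of n] assms(2) by simp
  then show "f z = 0" if "z \<in> unit_disc" for z
    using vanishes_to_all_imp_zero[OF Hol_disc_holomorphic[OF f] \<alpha> _ that] by blast
qed (use f in \<open>auto simp: Hol_disc_def\<close>)

text \<open>By biorthogonality every functional annihilates the difference of the two sides, which
  therefore vanishes to every order at \<alpha>.\<close>

lemma koenigs_expansion:
  assumes f: "f \<in> Hol_disc" and "finite A" and "\<And>n. n \<notin> A \<Longrightarrow> \<Psi> n f = 0"
  shows "f = (\<lambda>z. \<Sum>k\<in>A. \<Psi> k f * \<kappa>p k z)"
proof -
  define s where "s = (\<lambda>z. \<Sum>k\<in>A. \<Psi> k f * \<kappa>p k z)"
  have s: "s \<in> Hol_disc" unfolding s_def
    by (intro Hol_disc_combination koenigs_pow_in_Hol_disc)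
  have \<Psi>s: "\<Psi> n s = (if n \<in> A then \<Psi> n f else 0)" for n
    unfolding s_def using assms(2)
    by (subst koenigs_functional_combination)
      (simp_all add: koenigs_pow_in_Hol_disc koenigs_functional_koenigs_pow if_distrib sum.delta
        cong: if_cong)
  have d: "(\<lambda>z. f z - s z) = f + (\<lambda>z. (-1) * s z)" by auto
  have "\<Psi> n (\<lambda>z. f z - s z) = 0" for n
    unfolding d koenigs_functional_add[OF f Hol_disc_scale[OF s]] koenigs_functional_scale[OF s]
    using assms(3)[of n] by (simp add: \<Psi>s)
  then have "(\<lambda>z. f z - s z) = (\<lambda>z. 0)"
    by (intro koenigs_functional_zero_imp_zero Hol_disc_diff f s)
  then show ?thesis unfolding s_def[symmetric] by (auto simp: fun_eq_iff)
qed

end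

subsection \<open>Banach spaces of holomorphic functions\<close>

lemma banach_onD:
  assumes "banach_on X N"
  shows "cfun.subspace X" "\<forall>f\<in>X. 0 \<le> N f" "\<forall>c. \<forall>f\<in>X. N (\<lambda>z. c * f z) = cmod c * N f"
    "\<forall>f\<in>X. \<forall>g\<in>X. N (f + g) \<le> N f + N g"
proof -
  note D = assms[unfolded banach_on_def]
  show "cfun.subspace X" by (rule D[THEN conjunct1])
  show "\<forall>f\<in>X. 0 \<le> N f" by (rule D[THEN conjunct2, THEN conjunct1])
  show "\<forall>c. \<forall>f\<in>X. N (\<lambda>z. c * f z) = cmod c * N f"
    by (rule D[THEN conjunct2, THEN conjunct2, THEN conjunct2, THEN conjunct1])
  show "\<forall>f\<in>X. \<forall>g\<in>X. N (f + g) \<le> N f + N g"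
    by (rule D[THEN conjunct2, THEN conjunct2, THEN conjunct2, THEN conjunct2, THEN conjunct1])
qed

lemma banach_on_scale: "banach_on X N \<Longrightarrow> f \<in> X \<Longrightarrow> (\<lambda>z. c * f z) \<in> X"
  using cfun.subspace_scale[OF banach_onD(1)] .

lemma banach_on_add: "banach_on X N \<Longrightarrow> f \<in> X \<Longrightarrow> g \<in> X \<Longrightarrow> f + g \<in> X"
  using cfun.subspace_add[OF banach_onD(1)] .

lemma banach_on_zero: "banach_on X N \<Longrightarrow> (\<lambda>z. 0) \<in> X"
  using cfun.subspace_0[OF banach_onD(1)] unfolding zero_fun_def .

lemma banach_on_norm_scale:
  "banach_on X N \<Longrightarrow> f \<in> X \<Longrightarrow> N (\<lambda>z. c * f z) = cmod c * N f"
  using banach_onD(3) by blast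

lemma banach_on_norm_nonneg: "banach_on X N \<Longrightarrow> f \<in> X \<Longrightarrow> 0 \<le> N f"
  using banach_onD(2) by blast

lemma banach_on_norm_add:
  "banach_on X N \<Longrightarrow> f \<in> X \<Longrightarrow> g \<in> X \<Longrightarrow> N (f + g) \<le> N f + N g"
  using banach_onD(4) by blast

lemma banach_on_norm_zero: "banach_on X N \<Longrightarrow> N (\<lambda>z. 0) = 0"
  using banach_on_norm_scale[OF _ banach_on_zero, where c = 0] by simp

text \<open>Membership and norm bound go through one induction, since the triangle inequality
  applies only inside \<open>X\<close>.\<close>

lemma banach_on_combination:
  assumes X: "banach_on X N" and "\<And>k. k \<in> A \<Longrightarrow> f k \<in> X"
  shows "(\<lambda>z. \<Sum>k\<in>A. c k * f k z) \<in> X \<and>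
    N (\<lambda>z. \<Sum>k\<in>A. c k * f k z) \<le> (\<Sum>k\<in>A. cmod (c k) * N (f k))"
  using assms(2)
proof (induction A rule: infinite_finite_induct)
  case (insert x A)
  let ?g = "\<lambda>z. c x * f x z" and ?h = "\<lambda>z. \<Sum>k\<in>A. c k * f k z"
  have eq: "(\<lambda>z. \<Sum>k\<in>insert x A. c k * f k z) = ?g + ?h"
    using insert by auto
  have g: "?g \<in> X" "N ?g = cmod (c x) * N (f x)"
    using insert.prems X by (auto intro: banach_on_scale banach_on_norm_scale)
  have h: "?h \<in> X" "N ?h \<le> (\<Sum>k\<in>A. cmod (c k) * N (f k))"
    using insert by auto
  have "N (?g + ?h) \<le> N ?g + N ?h"
    by (rule banach_on_norm_add[OF X g(1) h(1)])
  then have "N (?g + ?h) \<le> (\<Sum>k\<in>insert x A. cmod (c k) * N (f k))"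
    using insert.hyps g(2) h(2) by simp
  then show ?case unfolding eq using banach_on_add[OF X g(1) h(1)] by blast
qed (simp_all add: banach_on_zero[OF X] banach_on_norm_zero[OF X])

text \<open>If no bound existed, suitably scaled functions would tend to 0 in norm, hence locally
  uniformly, while their \<open>n\<close>-th derivative at \<open>a\<close> stayed equal to
  1.\<close>

lemma embedded_higher_deriv_bounded:
  assumes X: "banach_on X N" and emb: "embedded_in_Hol X N" and a: "a \<in> unit_disc"
  shows "\<exists>C. \<forall>f\<in>X. cmod ((deriv ^^ n) f a) \<le> C * N f"
proof (rule ccontr)
  let ?L = "\<lambda>f. (deriv ^^ n) f a"
  have XH: "X \<subseteq> Hol_disc" using emb by (simp add: embedded_in_Hol_def)
  assume "\<not> ?thesis"
  then have "\<forall>k::nat. \<exists>f\<in>X. \<not> cmod (?L f) \<le> real (Suc k) * N f" by blast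
  then obtain f where f: "\<And>k. f k \<in> X" "\<And>k. real (Suc k) * N (f k) < cmod (?L (f k))"
    by (metis not_le)
  have pos: "0 < cmod (?L (f k))" for k
    using f(2)[of k] banach_on_norm_nonneg[OF X f(1)[of k]]
    by (meson le_less_trans mult_nonneg_nonneg of_nat_0_le_iff)
  define g where "g k = (\<lambda>z. 1 / ?L (f k) * f k z)" for k
  have gX: "g k \<in> X" for k unfolding g_def by (rule banach_on_scale[OF X f(1)])
  have Ng: "N (g k) \<le> inverse (real (Suc k))" for k
  proof -
    have "N (g k) = N (f k) / cmod (?L (f k))"
      unfolding g_def banach_on_norm_scale[OF X f(1)] by (simp add: norm_divide)
    also have "\<dots> \<le> inverse (real (Suc k))"
      using f(2)[of k] pos[of k] by (simp add: field_simps)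
    finally show ?thesis .
  qed
  have "(\<lambda>k. N (g k - (\<lambda>z. 0))) \<longlonglongrightarrow> 0"
  proof (rule tendsto_sandwich[OF _ _ tendsto_const LIMSEQ_inverse_real_of_nat])
    have "g k - (\<lambda>z. 0) = g k" for k by auto
    then show "\<forall>\<^sub>F k in sequentially. 0 \<le> N (g k - (\<lambda>z. 0))"
      "\<forall>\<^sub>F k in sequentially. N (g k - (\<lambda>z. 0)) \<le> inverse (real (Suc k))"
      using Ng banach_on_norm_nonneg[OF X gX] by auto
  qed
  then have ul: "uniform_limit K g (\<lambda>z. 0) sequentially" if "compact K" "K \<subseteq> unit_disc" for K
    using emb gX banach_on_zero[OF X] that unfolding embedded_in_Hol_def by blast
  obtain r where r: "r > 0" "cball a r \<subseteq> unit_disc"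
    using a open_contains_cball[of unit_disc] open_ball by blast
  have "(\<lambda>k. ?L (g k)) \<longlonglongrightarrow> ?L (\<lambda>z. 0)"
  proof (rule higher_deriv_complex_uniform_limit)
    show "uniform_limit (ball a r) g (\<lambda>z. 0) sequentially"
      by (rule uniform_limit_on_subset[OF ul[OF compact_cball r(2)]]) auto
    show "\<forall>\<^sub>F k in sequentially. g k holomorphic_on ball a r"
      using gX XH r ball_subset_cball[of a r]
      by (intro always_eventually allI holomorphic_on_subset[OF Hol_disc_holomorphic]) blast+
  qed (use r in auto)
  moreover have "?L (g k) = 1" for k
  proof -
    have "f k holomorphic_on unit_disc" using f(1) XH Hol_disc_holomorphic by blast
    then have "?L (g k) = 1 / ?L (f k) * ?L (f k)"
      unfolding g_def using a by (intro higher_deriv_cmult) auto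
    then show ?thesis using pos[of k] by simp
  qed
  moreover have "?L (\<lambda>z. 0) = 0" by (simp add: higher_deriv_const)
  ultimately show False by (simp add: LIMSEQ_const_iff)
qed

section \<open>The functionals on \<open>X\<close>: boundedness, invertibility and dimension\<close>

context koenigs_map
begin

text \<open>By the recursion, \<open>\<Psi> n f\<close> combines the \<open>n\<close>-th derivative
  at \<alpha> and the lower functionals with coefficients independent of \<open>f\<close>.\<close>

lemma koenigs_functional_bounded:
  assumes X: "banach_on X N" and emb: "embedded_in_Hol X N"
  shows "\<exists>C. \<forall>f\<in>X. cmod (\<Psi> n f) \<le> C * N f"
proof (induction n rule: less_induct)
  case (less n)
  have XH: "X \<subseteq> Hol_disc" using emb by (simp add: embedded_in_Hol_def)
  obtain C where C: "\<And>k f. k < n \<Longrightarrow> f \<in> X \<Longrightarrow> cmod (\<Psi> k f) \<le> C k * N f"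
    using less by metis
  obtain D where D: "\<And>f. f \<in> X \<Longrightarrow> cmod ((deriv ^^ n) f \<alpha>) \<le> D * N f"
    using embedded_higher_deriv_bounded[OF X emb \<alpha>] by blast
  define d where "d k = (deriv ^^ n) (\<kappa>p k) \<alpha>" for k
  have dsum: "(deriv ^^ n) (\<lambda>z. \<Sum>k\<in>A. c k * \<kappa>p k z) \<alpha> = (\<Sum>k\<in>A. c k * d k)" if "finite A" for A c
    using that
  proof (induction A)
    case (insert x A)
    have h: "(\<lambda>z. c x * \<kappa>p x z) holomorphic_on unit_disc"
      "(\<lambda>z. \<Sum>k\<in>A. c k * \<kappa>p k z) holomorphic_on unit_disc"
      using koenigs_pow_in_Hol_disc by (auto simp: Hol_disc_def intro!: holomorphic_intros)
    have "(deriv ^^ n) (\<lambda>z. c x * \<kappa>p x z + (\<Sum>k\<in>A. c k * \<kappa>p k z)) \<alpha>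
       = (deriv ^^ n) (\<lambda>z. c x * \<kappa>p x z) \<alpha> + (deriv ^^ n) (\<lambda>z. \<Sum>k\<in>A. c k * \<kappa>p k z) \<alpha>"
      using higher_deriv_add[OF h open_ball \<alpha>] .
    moreover have "(deriv ^^ n) (\<lambda>z. c x * \<kappa>p x z) \<alpha> = c x * d x"
      unfolding d_def using \<alpha> Hol_disc_holomorphic[OF koenigs_pow_in_Hol_disc]
      by (intro higher_deriv_cmult) auto
    ultimately show ?case using insert by simp
  qed (simp add: higher_deriv_const)
  have "cmod (\<Psi> n f) \<le> ((D + (\<Sum>k<n. C k * cmod (d k))) / fact n) * N f" if f: "f \<in> X" for f
  proof -
    have h: "f holomorphic_on unit_disc" "(\<lambda>z. \<Sum>k<n. \<Psi> k f * \<kappa>p k z) holomorphic_on unit_disc"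
      using koenigs_pow_in_Hol_disc f XH by (auto simp: Hol_disc_def intro!: holomorphic_intros)
    have "\<Psi> n f = ((deriv ^^ n) f \<alpha> - (\<Sum>k<n. \<Psi> k f * d k)) / fact n"
      unfolding koenigs_functional_eq[of n f] higher_deriv_diff[OF h open_ball \<alpha>]
      by (simp add: dsum)
    then have "cmod (\<Psi> n f) = cmod ((deriv ^^ n) f \<alpha> - (\<Sum>k<n. \<Psi> k f * d k)) / fact n"
      by (simp add: norm_divide)
    also have "\<dots> \<le> (cmod ((deriv ^^ n) f \<alpha>) + (\<Sum>k<n. cmod (\<Psi> k f) * cmod (d k))) / fact n"
      by (intro divide_right_mono order_trans[OF norm_triangle_ineq4] add_mono)
        (auto intro!: order_trans[OF norm_sum] simp: norm_mult)
    also have "\<dots> \<le> (D * N f + (\<Sum>k<n. (C k * N f) * cmod (d k))) / fact n"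
      using C D f by (intro divide_right_mono add_mono sum_mono mult_right_mono) auto
    also have "\<dots> = ((D + (\<Sum>k<n. C k * cmod (d k))) / fact n) * N f"
      by (simp add: algebra_simps sum_distrib_left sum_distrib_right)
    finally show ?thesis .
  qed
  then show ?case by blast
qed

text \<open>If \<open>T\<close> has the inverse \<open>S\<close>, then \<open>\<Psi> n (S ^ k f) = lam ^ (- n * k) * \<Psi> n f\<close>; comparing growth
  in \<open>k\<close> bounds \<open>cmod lam ^ (- n)\<close> by the norm of \<open>S\<close> whenever \<open>\<Psi> n f \<noteq> 0\<close>.\<close>

lemma finite_functionals_if_invertible:
  assumes X: "banach_on X N" and emb: "embedded_in_Hol X N"
    and inv: "0 \<notin> spectrum_on X N (comp_op \<phi>)"
  shows "finite {n. \<exists>f\<in>X. \<Psi> n f \<noteq> 0}"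
proof -
  have XH: "X \<subseteq> Hol_disc" using emb by (simp add: embedded_in_Hol_def)
  obtain S where S: "bounded_op_on X N S" "\<And>f. f \<in> X \<Longrightarrow> (\<lambda>z. 0 * S f z) - comp_op \<phi> (S f) = f"
    using inv unfolding spectrum_on_def by auto
  have SX: "S f \<in> X" if "f \<in> X" for f using S(1) that by (auto simp: bounded_op_on_def)
  \<comment> \<open>At the point 0 the resolvent inverts \<open>0 - T\<close>, hence the sign; it
    disappears on taking moduli.\<close>
  have TS: "comp_op \<phi> (S f) = (\<lambda>z. -1 * f z)" if "f \<in> X" for f
  proof
    fix z
    show "comp_op \<phi> (S f) z = -1 * f z" using fun_cong[OF S(2)[OF that], of z] by (simp add: minus_equation_iff)
  qed
  obtain C0 where C0: "\<And>f. f \<in> X \<Longrightarrow> N (S f) \<le> C0 * N f"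
    using S(1) unfolding bounded_op_on_def by blast
  \<comment> \<open>The maximum with 1 allows division by \<open>C\<close>.\<close>
  define C where "C = max C0 1"
  have C: "N (S f) \<le> C * N f" if "f \<in> X" for f
    using C0[OF that] banach_on_norm_nonneg[OF X that]
    by (smt (verit) C_def max.cobounded1 mult_right_mono)
  have C1: "C \<ge> 1" by (simp add: C_def)
  have iter: "(S ^^ k) f \<in> X \<and> N ((S ^^ k) f) \<le> C ^ k * N f \<and>
      cmod (\<Psi> n f) = cmod lam ^ (n * k) * cmod (\<Psi> n ((S ^^ k) f))" if f: "f \<in> X" for n k f
  proof (induction k)
    case (Suc k)
    let ?g = "(S ^^ k) f"
    have g: "?g \<in> X" using Suc by simp
    have gH: "?g \<in> Hol_disc" "S ?g \<in> Hol_disc" using g SX[OF g] XH by blast+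
    have "N (S ?g) \<le> C * N ?g" by (rule C[OF g])
    also have "\<dots> \<le> C * (C ^ k * N f)" using Suc C1 by (intro mult_left_mono) auto
    finally have "N (S ?g) \<le> C ^ Suc k * N f" by simp
    moreover have "lam ^ n * \<Psi> n (S ?g) = - \<Psi> n ?g"
      using koenigs_functional_comp_op[OF gH(2), of n]
      unfolding TS[OF g] koenigs_functional_scale[OF gH(1)] by simp
    then have "cmod (\<Psi> n ?g) = cmod lam ^ n * cmod (\<Psi> n (S ?g))"
      by (metis norm_minus_cancel norm_mult norm_power)
    ultimately show ?case using Suc SX[OF g] by (simp add: power_add)
  qed (use f in auto)
  \<comment> \<open>From \<open>M\<close> on, \<open>cmod lam ^ n * C < 1\<close>, so the growth of
    the iterates of \<open>S\<close> cannot make up for the factor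
    \<open>cmod lam ^ (n * k)\<close>.\<close>
  obtain M where M: "cmod lam ^ M < 1 / C"
    using real_arch_pow_inv[of "1 / C" "cmod lam"] norm_lam C1 by auto
  have "n < M" if f: "f \<in> X" and nz: "\<Psi> n f \<noteq> 0" for n f
  proof (rule ccontr)
    assume "\<not> n < M"
    then have "cmod lam ^ n \<le> cmod lam ^ M"
      using norm_lam by (intro power_decreasing) auto
    with M have "cmod lam ^ n < 1 / C" by simp
    then have b: "cmod lam ^ n * C < 1" using C1 by (simp add: field_simps)
    obtain D where D: "\<And>f. f \<in> X \<Longrightarrow> cmod (\<Psi> n f) \<le> D * N f"
      using koenigs_functional_bounded[OF X emb] by blast
    have "cmod (\<Psi> n f) \<le> (cmod lam ^ n * C) ^ k * (max D 0 * N f)" for k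
    proof -
      let ?g = "(S ^^ k) f"
      have "cmod (\<Psi> n ?g) \<le> D * N ?g" using D iter[OF f] by blast
      also have "\<dots> \<le> max D 0 * (C ^ k * N f)"
        using iter[OF f, of k n] banach_on_norm_nonneg[OF X, of ?g] by (intro mult_mono) auto
      finally have "cmod lam ^ (n * k) * cmod (\<Psi> n ?g) \<le> cmod lam ^ (n * k) * (max D 0 * (C ^ k * N f))"
        by (intro mult_left_mono) auto
      also have "\<dots> = (cmod lam ^ n * C) ^ k * (max D 0 * N f)"
        unfolding power_mult power_mult_distrib by (simp only: mult_ac)
      finally show ?thesis using iter[OF f, of k n] by simp
    qed
    moreover have "(\<lambda>k. (cmod lam ^ n * C) ^ k * (max D 0 * N f)) \<longlonglongrightarrow> 0"
      using b C1 by (intro tendsto_mult_left_zero LIMSEQ_power_zero) auto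
    ultimately have "cmod (\<Psi> n f) \<le> 0"
      by (intro LIMSEQ_le_const) auto
    then show False using nz by simp
  qed
  then have "{n. \<exists>f\<in>X. \<Psi> n f \<noteq> 0} \<subseteq> {..<M}" by auto
  then show ?thesis by (rule finite_subset) simp
qed

text \<open>Applying \<open>T - lam ^ m\<close> removes \<open>\<kappa>p m\<close> and multiplies
  the coefficient of \<open>\<kappa>p l\<close> by the nonzero number
  \<open>lam ^ l - lam ^ m\<close>. Doing so for each \<open>m\<close> in \<open>B\<close> leaves a
  multiple of \<open>\<kappa>p l\<close>.\<close>

lemma koenigs_pow_in_if_coefficient:
  assumes X: "banach_on X N" and T: "comp_op \<phi> ` X \<subseteq> X"
    and "finite B" "l \<notin> B" "c l \<noteq> 0" "(\<lambda>z. \<Sum>k\<in>insert l B. c k * \<kappa>p k z) \<in> X"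
  shows "\<kappa>p l \<in> X"
  using assms(3-)
proof (induction B arbitrary: c rule: finite_induct)
  case empty
  have "(\<lambda>z. 1 / c l * (\<Sum>k\<in>{l}. c k * \<kappa>p k z)) \<in> X"
    by (rule banach_on_scale[OF X empty.prems(3)])
  then show ?case using empty.prems(2) by simp
next
  case (insert m B)
  let ?f = "\<lambda>z. \<Sum>k\<in>insert l (insert m B). c k * \<kappa>p k z"
  have "comp_op \<phi> ?f + (\<lambda>z. - (lam ^ m) * ?f z) \<in> X"
    using insert.prems T by (intro banach_on_add[OF X] banach_on_scale[OF X]) auto
  also have "comp_op \<phi> ?f + (\<lambda>z. - (lam ^ m) * ?f z)
      = (\<lambda>z. \<Sum>k\<in>insert l B. (c k * (lam ^ k - lam ^ m)) * \<kappa>p k z)"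
  proof
    fix z
    have "(comp_op \<phi> ?f + (\<lambda>z. - (lam ^ m) * ?f z)) z
        = (\<Sum>k\<in>insert l (insert m B). c k * (lam ^ k * \<kappa>p k z)) - lam ^ m * ?f z"
      unfolding comp_op_combination comp_op_koenigs_pow by simp
    also have "\<dots> = (\<Sum>k\<in>insert m (insert l B). (c k * (lam ^ k - lam ^ m)) * \<kappa>p k z)"
      unfolding sum_distrib_left sum_subtractf[symmetric] insert_commute[of l m]
      by (intro sum.cong) (auto simp: algebra_simps)
    also have "\<dots> = (\<Sum>k\<in>insert l B. (c k * (lam ^ k - lam ^ m)) * \<kappa>p k z)"
      using insert by (subst sum.insert) auto
    finally show "(comp_op \<phi> ?f + (\<lambda>z. - (lam ^ m) * ?f z)) z
        = (\<Sum>k\<in>insert l B. (c k * (lam ^ k - lam ^ m)) * \<kappa>p k z)" .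
  qed
  finally have "(\<lambda>z. \<Sum>k\<in>insert l B. (c k * (lam ^ k - lam ^ m)) * \<kappa>p k z) \<in> X" .
  moreover have "c l * (lam ^ l - lam ^ m) \<noteq> 0"
    using insert lam_pow_inject[of l m] by auto
  ultimately show ?case using insert by (intro insert.IH) auto
qed

text \<open>The finite expansion gives one inclusion. For the other, each index has a function in
  \<open>X\<close> with nonzero coefficient there, from which the power is isolated.\<close>

lemma koenigs_span_if_finite_functionals:
  assumes X: "banach_on X N" and emb: "embedded_in_Hol X N" and T: "comp_op \<phi> ` X \<subseteq> X"
    and fin: "finite {n. \<exists>f\<in>X. \<Psi> n f \<noteq> 0}"
  shows "X = cfun.span {\<kappa>p l |l. l \<in> {n. \<exists>f\<in>X. \<Psi> n f \<noteq> 0}}"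
proof
  define J where "J = {n. \<exists>f\<in>X. \<Psi> n f \<noteq> 0}"
  have XH: "X \<subseteq> Hol_disc" using emb by (simp add: embedded_in_Hol_def)
  have exp: "f = (\<lambda>z. \<Sum>k\<in>J. \<Psi> k f * \<kappa>p k z)" if "f \<in> X" for f
    using that XH fin by (intro koenigs_expansion) (auto simp: J_def)
  show "X \<subseteq> cfun.span {\<kappa>p l |l. l \<in> {n. \<exists>f\<in>X. \<Psi> n f \<noteq> 0}}"
    unfolding J_def[symmetric]
  proof
    fix f assume "f \<in> X"
    then have f: "f = (\<Sum>k\<in>J. (\<lambda>z. \<Psi> k f * \<kappa>p k z))"
      using exp by (simp add: fun_eq_iff sum_fun_apply)
    have "(\<Sum>k\<in>J. (\<lambda>z. \<Psi> k f * \<kappa>p k z)) \<in> cfun.span {\<kappa>p l |l. l \<in> J}"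
      by (intro cfun.span_sum cfun.span_scale cfun.span_base) auto
    then show "f \<in> cfun.span {\<kappa>p l |l. l \<in> J}" using f by simp
  qed
  have "\<kappa>p l \<in> X" if l: "l \<in> J" for l
  proof -
    obtain f where f: "f \<in> X" "\<Psi> l f \<noteq> 0" using l by (auto simp: J_def)
    have "insert l (J - {l}) = J" using l by auto
    then show ?thesis
      using koenigs_pow_in_if_coefficient[OF X T, of "J - {l}" l "\<lambda>k. \<Psi> k f"] exp[OF f(1)] f fin
      by (simp add: J_def)
  qed
  moreover have "cfun.subspace X" using X by (rule banach_onD)
  ultimately show "cfun.span {\<kappa>p l |l. l \<in> {n. \<exists>f\<in>X. \<Psi> n f \<noteq> 0}} \<subseteq> X"
    unfolding J_def[symmetric] by (intro cfun.span_minimal) auto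
qed

lemma invertible_if_finite_functionals:
  assumes X: "banach_on X N" and emb: "embedded_in_Hol X N" and T: "comp_op \<phi> ` X \<subseteq> X"
    and fin: "finite {n. \<exists>f\<in>X. \<Psi> n f \<noteq> 0}"
  shows "0 \<notin> spectrum_on X N (comp_op \<phi>)"
proof -
  define J where "J = {n. \<exists>f\<in>X. \<Psi> n f \<noteq> 0}"
  have finJ: "finite J" using fin by (simp add: J_def)
  have XH: "X \<subseteq> Hol_disc" using emb by (simp add: embedded_in_Hol_def)
  have exp: "(\<lambda>z. \<Sum>k\<in>J. \<Psi> k f * \<kappa>p k z) = f" if "f \<in> X" for f
    by (rule koenigs_expansion[symmetric]) (use that XH finJ in \<open>auto simp: J_def\<close>)
  have \<kappa>X: "\<kappa>p l \<in> X" if "l \<in> J" for l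
    by (subst koenigs_span_if_finite_functionals[OF assms, folded J_def])
      (use that in \<open>auto intro: cfun.span_base\<close>)
  \<comment> \<open>The diagonal inverse of \<open>0 - T\<close> on the powers of
    \<open>\<kappa>\<close>; the minus sign comes from the resolvent convention.\<close>
  define S where "S f = (\<lambda>z. \<Sum>k\<in>J. (- \<Psi> k f / lam ^ k) * \<kappa>p k z)" for f
  have S_comb: "S f \<in> X \<and> N (S f) \<le> (\<Sum>k\<in>J. cmod (- \<Psi> k f / lam ^ k) * N (\<kappa>p k))" for f
    unfolding S_def by (rule banach_on_combination[OF X]) (rule \<kappa>X)
  note SX = S_comb[THEN conjunct1] S_comb[THEN conjunct2]
  have "bounded_op_on X N S"
    unfolding bounded_op_on_def
  proof (intro conjI ballI allI)
    show "S ` X \<subseteq> X" using SX by auto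
    show "S (f + g) = S f + S g" if "f \<in> X" "g \<in> X" for f g
    proof -
      have "\<Psi> k (f + g) = \<Psi> k f + \<Psi> k g" for k
        using that XH by (intro koenigs_functional_add) auto
      then show ?thesis
        by (simp add: S_def fun_eq_iff sum.distrib[symmetric] add_divide_distrib diff_divide_distrib algebra_simps)
    qed
    show "S (\<lambda>z. c * f z) = (\<lambda>z. c * S f z)" if "f \<in> X" for c f
    proof -
      have "\<Psi> k (\<lambda>z. c * f z) = c * \<Psi> k f" for k
        using that XH by (intro koenigs_functional_scale) auto
      then show ?thesis
        by (simp add: S_def fun_eq_iff sum_distrib_left mult.assoc)
    qed
    obtain C where C: "\<And>k f. f \<in> X \<Longrightarrow> cmod (\<Psi> k f) \<le> C k * N f"
      using koenigs_functional_bounded[OF X emb] by metis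
    show "\<exists>C. \<forall>f\<in>X. N (S f) \<le> C * N f"
    proof (intro exI ballI)
      fix f assume f: "f \<in> X"
      have "N (S f) \<le> (\<Sum>k\<in>J. cmod (\<Psi> k f) / cmod lam ^ k * N (\<kappa>p k))"
        using SX(2)[of f] by (simp add: norm_divide norm_power)
      also have "\<dots> \<le> (\<Sum>k\<in>J. (C k * N f) / cmod lam ^ k * N (\<kappa>p k))"
        using C[OF f] banach_on_norm_nonneg[OF X \<kappa>X]
        by (intro sum_mono mult_right_mono divide_right_mono) auto
      also have "\<dots> = (\<Sum>k\<in>J. C k / cmod lam ^ k * N (\<kappa>p k)) * N f"
        by (simp add: sum_distrib_left mult_ac)
      finally show "N (S f) \<le> (\<Sum>k\<in>J. C k / cmod lam ^ k * N (\<kappa>p k)) * N f" .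
    qed
  qed
  moreover have "S ((\<lambda>z. 0 * f z) - comp_op \<phi> f) = f \<and>
      (\<lambda>z. 0 * S f z) - comp_op \<phi> (S f) = f" if f: "f \<in> X" for f
  proof
    have eq: "(\<lambda>z. 0 * f z) - comp_op \<phi> f = (\<lambda>z. -1 * comp_op \<phi> f z)" by auto
    have "\<Psi> k (\<lambda>z. -1 * comp_op \<phi> f z) = - (lam ^ k * \<Psi> k f)" for k
      using f XH koenigs_functional_scale[OF comp_op_in_Hol_disc, of f k "-1"]
        koenigs_functional_comp_op[of f k] by auto
    then show "S ((\<lambda>z. 0 * f z) - comp_op \<phi> f) = f"
      unfolding eq S_def using exp[OF f] deriv_nz by simp
    have "comp_op \<phi> (S f) = (\<lambda>z. \<Sum>k\<in>J. - (\<Psi> k f * \<kappa>p k z))"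
      unfolding S_def comp_op_combination comp_op_koenigs_pow using deriv_nz by simp
    then have "(\<lambda>z. 0 * S f z) - comp_op \<phi> (S f) = (\<lambda>z. \<Sum>k\<in>J. \<Psi> k f * \<kappa>p k z)"
      by (auto simp: fun_eq_iff sum_negf)
    then show "(\<lambda>z. 0 * S f z) - comp_op \<phi> (S f) = f" using exp[OF f] by simp
  qed
  ultimately show ?thesis unfolding spectrum_on_def by blast
qed

text \<open>The powers \<open>T ^ k b\<close> of each spanning vector \<open>b\<close> are linearly dependent, which gives a
  polynomial that has \<open>lam ^ n\<close> as a root whenever \<open>\<Psi> n b \<noteq> 0\<close>.\<close>

lemma finite_functionals_if_finite_dimensional:
  assumes emb: "embedded_in_Hol X N" and T: "comp_op \<phi> ` X \<subseteq> X"
    and "finite_dimensional X"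
  shows "finite {n. \<exists>f\<in>X. \<Psi> n f \<noteq> 0}"
proof -
  have XH: "X \<subseteq> Hol_disc" using emb by (simp add: embedded_in_Hol_def)
  obtain B where B: "finite B" "B \<subseteq> X" "cfun.span B = X"
    using assms(3) unfolding finite_dimensional_def by blast
  have "finite {n. \<Psi> n b \<noteq> 0}" if b: "b \<in> B" for b
  proof -
    define v where "v k = (comp_op \<phi> ^^ k) b" for k
    have v: "v k \<in> X" "\<Psi> n (v k) = (lam ^ n) ^ k * \<Psi> n b" for n k
    proof (induction k)
      case (Suc k)
      { case 1 then show ?case using Suc T by (auto simp: v_def) }
      { case 2 then show ?case
          using Suc XH koenigs_functional_comp_op[of "v k" n] by (auto simp: v_def) }
    qed (use b B in \<open>auto simp: v_def\<close>)
    \<comment> \<open>There are \<open>card B + 1\<close> vectors in the span of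
      \<open>card B\<close>, so a nontrivial relation holds. Dependence is a property of sets, hence
      repetitions among the \<open>v k\<close> are treated apart.\<close>
    obtain c m where c: "m \<le> card B" "c m \<noteq> 0"
      "(\<lambda>z. \<Sum>k\<le>card B. c k * v k z) = (\<lambda>z. 0)"
    proof (cases "inj_on v {..card B}")
      case True
      have "cfun.dependent (v ` {..card B})"
      proof (rule ccontr)
        assume "cfun.independent (v ` {..card B})"
        then have "card (v ` {..card B}) \<le> card B"
          using cfun.independent_span_bound[OF B(1)] v(1) B(3) by blast
        then show False using card_image[OF True] by simp
      qed
      then obtain u where u: "\<exists>w\<in>v ` {..card B}. u w \<noteq> 0"
          "(\<Sum>w\<in>v ` {..card B}. (\<lambda>z. u w * w z)) = 0"
        by (subst (asm) cfun.dependent_finite) auto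
      then obtain m where "m \<le> card B" "u (v m) \<noteq> 0" by auto
      moreover have "(\<lambda>z. \<Sum>k\<le>card B. u (v k) * v k z) = (\<lambda>z. 0)"
        using u(2) unfolding sum.reindex[OF True] by (auto simp: fun_eq_iff sum_fun_apply)
      ultimately show ?thesis using that[of m "\<lambda>k. u (v k)"] by blast
    next
      case False
      then obtain i j where ij: "i \<le> card B" "j \<le> card B" "i \<noteq> j" "v i = v j"
        by (auto simp: inj_on_def)
      let ?c = "\<lambda>k. (if k = i then 1 else 0) - (if k = j then 1 else 0) :: complex"
      have "(\<Sum>k\<le>card B. ?c k * v k z) = v i z - v j z" for z
        using ij by (simp add: left_diff_distrib sum_subtractf if_distrib[of "\<lambda>c. c * _"] sum.delta cong: if_cong)
      then show ?thesis using that[of i ?c] ij by auto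
    qed
    define p where "p = (\<Sum>k\<le>card B. monom (c k) k)"
    have "coeff p m = c m" using c(1) by (simp add: p_def coeff_sum)
    then have "p \<noteq> 0" using c(2) by auto
    have "poly p (lam ^ n) = 0" if n: "\<Psi> n b \<noteq> 0" for n
    proof -
      have "v k \<in> Hol_disc" for k using v(1) XH by blast
      then have "(\<Sum>k\<le>card B. c k * \<Psi> n (v k)) = \<Psi> n (\<lambda>z. 0)"
        using koenigs_functional_combination[of "{..card B}" v n c] c(3) by simp
      also have "\<dots> = 0"
        using koenigs_functional_scale[of b n 0] b B XH by auto
      finally have "poly p (lam ^ n) * \<Psi> n b = 0"
        by (simp add: v(2) p_def poly_sum poly_monom sum_distrib_right mult.assoc)
      then show ?thesis using n by simp
    qed
    then have "(\<lambda>n. lam ^ n) ` {n. \<Psi> n b \<noteq> 0} \<subseteq> {x. poly p x = 0}" by auto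
    moreover have "finite {x. poly p x = 0}" by (rule poly_roots_finite[OF \<open>p \<noteq> 0\<close>])
    moreover have "inj_on (\<lambda>n. lam ^ n) {n. \<Psi> n b \<noteq> 0}"
      by (auto simp: inj_on_def lam_pow_inject)
    ultimately show ?thesis by (metis finite_subset finite_imageD)
  qed
  then have "finite (\<Union>b\<in>B. {n. \<Psi> n b \<noteq> 0})" using B(1) by blast
  \<comment> \<open>A functional that vanishes on the spanning set vanishes on \<open>X\<close>, so
    the finitely many vectors in \<open>B\<close> account for all nonzero functionals.\<close>
  moreover have "{n. \<exists>f\<in>X. \<Psi> n f \<noteq> 0} \<subseteq> (\<Union>b\<in>B. {n. \<Psi> n b \<noteq> 0})"
  proof clarify
    fix n f assume f: "f \<in> X" and nz: "\<Psi> n f \<noteq> 0"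
    have "\<exists>u. f = (\<Sum>b\<in>B. (\<lambda>z. u b * b z))"
      using f B(3) cfun.span_finite[OF B(1)] by auto
    then obtain u where "f = (\<lambda>z. \<Sum>b\<in>B. u b * b z)"
      by (auto simp: fun_eq_iff sum_fun_apply)
    then have "\<Psi> n f = (\<Sum>b\<in>B. u b * \<Psi> n b)"
      using koenigs_functional_combination[of B "\<lambda>b. b" n u] B XH by auto
    then show "n \<in> (\<Union>b\<in>B. {n. \<Psi> n b \<noteq> 0})"
      using nz by (metis (mono_tags, lifting) UN_I mem_Collect_eq mult_zero_right sum.neutral)
  qed
  ultimately show ?thesis by (rule rev_finite_subset)
qed

end

section \<open>Closing the cycle of implications\<close>

theorem proposition5p4:
  fixes \<phi> :: "complex \<Rightarrow> complex" and \<alpha> :: complex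
    and X :: "(complex \<Rightarrow> complex) set" and N :: "(complex \<Rightarrow> complex) \<Rightarrow> real"
  assumes "\<phi> holomorphic_on unit_disc" and "\<phi> ` unit_disc \<subseteq> unit_disc"
    and "\<not> Aut_disc \<phi>"
    and "\<alpha> \<in> unit_disc" and "\<phi> \<alpha> = \<alpha>" and "deriv \<phi> \<alpha> \<noteq> 0"
    and "banach_on X N" and "embedded_in_Hol X N"
    and "comp_op \<phi> ` X \<subseteq> X"
  shows
    "((0 \<notin> spectrum_on X N (comp_op \<phi>)) \<longleftrightarrow>
        finite {n. \<exists>f\<in>X. koenigs_functional \<phi> \<alpha> n f \<noteq> 0}) \<and>
     (finite {n. \<exists>f\<in>X. koenigs_functional \<phi> \<alpha> n f \<noteq> 0} \<longleftrightarrow>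
        (\<exists>J. finite J \<and> X = cfun.span {koenigs_pow \<phi> \<alpha> l |l. l \<in> J})) \<and>
     ((\<exists>J. finite J \<and> X = cfun.span {koenigs_pow \<phi> \<alpha> l |l. l \<in> J}) \<longleftrightarrow>
        finite_dimensional X)"
proof -
  interpret koenigs_map \<phi> \<alpha> using assms(1-6) by unfold_locales
  let ?i = "0 \<notin> spectrum_on X N (comp_op \<phi>)"
    and ?ii = "finite {n. \<exists>f\<in>X. \<Psi> n f \<noteq> 0}"
    and ?iii = "\<exists>J. finite J \<and> X = cfun.span {\<kappa>p l |l. l \<in> J}"
  have "?i \<longleftrightarrow> ?ii"
    using finite_functionals_if_invertible invertible_if_finite_functionals assms(7-9) by blast
  moreover have "?ii \<Longrightarrow> ?iii"
    using koenigs_span_if_finite_functionals[OF assms(7-9)] by blast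
  moreover have "?iii \<Longrightarrow> finite_dimensional X"
  proof (elim exE conjE)
    fix J :: "nat set" assume J: "finite J" "X = cfun.span {\<kappa>p l |l. l \<in> J}"
    then show "finite_dimensional X"
      unfolding finite_dimensional_def
      by (intro exI[of _ "{\<kappa>p l |l. l \<in> J}"]) (auto intro: cfun.span_base)
  qed
  moreover have "finite_dimensional X \<Longrightarrow> ?ii"
    by (rule finite_functionals_if_finite_dimensional[OF assms(8,9)])
  ultimately show ?thesis by blast
qed

end
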